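(* The modal logic $\mathsf{ML}_{\Box}$ is undecidable, i.e. there is no algorithm which, given a formula $\varphi$ of the basic modal language, decides whether $\varphi\in\mathsf{ML}_{\Box}$.
   Context: For $n\in\omega$ let $[n]$ be an $n$-element set and $M_n=(\mathcal{P}([n])\setminus\{\varnothing\},\supseteq)$, the set of non-empty subsets of $[n]$ with accessibility relation $\supseteq$. $\mathsf{ML}_{\Box}$ is the set of formulas in the basic (unimodal) classical modal language that are valid in every modal Kripke frame $M_n$, $n\in\omega$ (so $\Box\varphi$ holds at $x$ iff $\varphi$ holds at every non-empty $y\subseteq x$). *)

theory Defs
  imports Main "HOL-Library.Nat_Bijection"
begin

section \<open>Basic modal language and Kripke semantics\<close>

text \<open>The remaining Boolean connectives and the diamond are definable as usual from
  \<open>\<bottom>\<close>, implication and box.\<close>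

datatype fm = Atom nat | Bot | Imp fm fm | Box fm

text \<open>A frame is a set of worlds with an accessibility relation.\<close>

type_synonym 'w frame = "'w set \<times> ('w \<times> 'w) set"

fun sat :: "'w frame \<Rightarrow> (nat \<Rightarrow> 'w set) \<Rightarrow> 'w \<Rightarrow> fm \<Rightarrow> bool" where
  "sat F V w (Atom p) \<longleftrightarrow> w \<in> V p"
| "sat F V w Bot \<longleftrightarrow> False"
| "sat F V w (Imp \<phi> \<psi>) \<longleftrightarrow> (sat F V w \<phi> \<longrightarrow> sat F V w \<psi>)"
| "sat F V w (Box \<phi>) \<longleftrightarrow> (\<forall>v\<in>fst F. (w, v) \<in> snd F \<longrightarrow> sat F V v \<phi>)"

definition valid :: "'w frame \<Rightarrow> fm \<Rightarrow> bool" where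
  "valid F \<phi> \<longleftrightarrow> (\<forall>V. (\<forall>p. V p \<subseteq> fst F) \<longrightarrow> (\<forall>w\<in>fst F. sat F V w \<phi>))"

section \<open>The logic of the frames of non-empty subsets\<close>

text \<open>For \<open>n = 0\<close> the frame is empty and validates every formula, so it does not affect the logic.\<close>

definition medvedev_frame :: "nat \<Rightarrow> nat set frame" where
  "medvedev_frame n =
    (let W = Pow {..<n} - {{}} in (W, {(x, y). x \<in> W \<and> y \<in> W \<and> x \<supseteq> y}))"

definition MLBox :: "fm set" where
  "MLBox = {\<phi>. \<forall>n. valid (medvedev_frame n) \<phi>}"

section \<open>Decidability\<close>

text \<open>Algorithms are the partial recursive functions. \<open>rec_eval f xs y\<close> says that \<open>f\<close> is defined
  on the argument tuple \<open>xs\<close> with value \<open>y\<close>.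
  Arities are left implicit: \<open>Zero\<close> is the constant zero function of every arity, and a term is
  undefined on tuples on which a part of it receives too few arguments, or \<open>Succ\<close> not exactly one.
  In \<open>PrimRec f g\<close> the recursion runs on the first argument and \<open>g\<close> receives
  predecessor, previous value and parameters; \<open>Mu f\<close> is unbounded search for the least zero, and
  requires \<open>f\<close> to be defined at all smaller values.\<close>

datatype recf = Zero | Succ | Proj nat | Comp recf "recf list" | PrimRec recf recf | Mu recf

inductive rec_eval :: "recf \<Rightarrow> nat list \<Rightarrow> nat \<Rightarrow> bool" where
  Zero: "rec_eval Zero xs 0"
| Succ: "rec_eval Succ [x] (Suc x)"
| Proj: "i < length xs \<Longrightarrow> rec_eval (Proj i) xs (xs ! i)"
| Comp: "list_all2 (\<lambda>g y. rec_eval g xs y) gs ys \<Longrightarrow> rec_eval f ys z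
    \<Longrightarrow> rec_eval (Comp f gs) xs z"
| PrimRec_0: "rec_eval f xs y \<Longrightarrow> rec_eval (PrimRec f g) (0 # xs) y"
| PrimRec_Suc: "rec_eval (PrimRec f g) (n # xs) r \<Longrightarrow> rec_eval g (n # r # xs) y
    \<Longrightarrow> rec_eval (PrimRec f g) (Suc n # xs) y"
| Mu: "rec_eval f (n # xs) 0 \<Longrightarrow> (\<forall>m<n. \<exists>k. rec_eval f (m # xs) (Suc k))
    \<Longrightarrow> rec_eval (Mu f) xs n"
monos list.rel_mono_strong

lemma rec_eval_deterministic: "rec_eval f xs y \<Longrightarrow> rec_eval f xs z \<Longrightarrow> y = z"
proof (induction arbitrary: z rule: rec_eval.induct)
  case (Comp xs gs ys f u)
  from Comp.prems obtain ys' where ys': "list_all2 (\<lambda>g y. rec_eval g xs y) gs ys'" "rec_eval f ys' z"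
    by (cases rule: rec_eval.cases) auto
  have "ys = ys'"
    using Comp.IH(1) Comp.hyps ys'(1) by (auto simp: list_all2_conv_all_nth intro!: nth_equalityI)
  with ys'(2) Comp.IH show ?case by blast
next
  case (PrimRec_0 f xs y g)
  from PrimRec_0.prems show ?case
    by (cases rule: rec_eval.cases) (auto intro: PrimRec_0.IH)
next
  case (PrimRec_Suc f g n xs r y)
  from PrimRec_Suc.prems show ?case
    by (cases rule: rec_eval.cases) (use PrimRec_Suc.IH in blast)+
next
  case (Mu f n xs)
  from Mu.prems have z: "rec_eval f (z # xs) 0" "\<forall>m<z. \<exists>k. rec_eval f (m # xs) (Suc k)"
    by (cases rule: rec_eval.cases; auto)+
  show ?case
  proof (cases n z rule: linorder_cases)
    case less
    with z(2) Mu.IH(1) show ?thesis by blast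
  next
    case greater
    with z(1) Mu.IH(2) show ?thesis by blast
  qed
qed (auto elim: rec_eval.cases)

text \<open>A set of objects coded by numbers is decidable if some algorithm, given the code of any object,
  halts and answers correctly. Nothing is required on numbers that are not codes.\<close>

definition decidable :: "('a \<Rightarrow> nat) \<Rightarrow> 'a set \<Rightarrow> bool" where
  "decidable code A \<longleftrightarrow> (\<exists>f. \<forall>a. rec_eval f [code a] (if a \<in> A then 1 else 0))"

text \<open>The standard Goedel numbering of formulas by means of the Cantor pairing function.\<close>

fun fm_code :: "fm \<Rightarrow> nat" where
  "fm_code (Atom p) = prod_encode (0, p)"
| "fm_code Bot = prod_encode (1, 0)"
| "fm_code (Imp \<phi> \<psi>) = prod_encode (2, prod_encode (fm_code \<phi>, fm_code \<psi>))"
| "fm_code (Box \<phi>) = prod_encode (3, fm_code \<phi>)"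

lemma fm_code_inject: "fm_code \<phi> = fm_code \<psi> \<longleftrightarrow> \<phi> = \<psi>"
proof (induction \<phi> arbitrary: \<psi>)
  case (Atom p) show ?case by (cases \<psi>) auto
next
  case Bot show ?case by (cases \<psi>) auto
next
  case (Imp \<phi>1 \<phi>2) then show ?case by (cases \<psi>) auto
next
  case (Box \<phi>) then show ?case by (cases \<psi>) auto
qed

end

theory Submission
  imports Defs Complex_Main "HOL-Library.Countable"
begin

text \<open>
  Since the worlds of the frames are closed under unions, a boxed formula can talk about all tuples
  of points at once. Colouring the points, labelling sets with one point of each of several colours
  by relation symbols, and using one world per colour that collects all its points, one can express
  arbitrary clauses \<open>\<forall>\<dots>\<exists>\<dots>\<close> over finite relational structures. Derivations of the evaluation relation of
  partial recursive functions are finite structures axiomatised by such clauses. Hence every partial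
  recursive \<open>f\<close> has a formula \<open>\<psi>\<close> such that \<open>f\<close> halts on \<open>x\<close> iff \<open>\<psi>\<close> is satisfiable together with a formula
  that fixes the input \<open>x\<close> and depends on nothing else. Given a decision procedure, let \<open>f\<close> halt on the code
  of a formula iff this formula is not satisfiable together with the input formula for its code. Running
  this \<open>f\<close> on the code of its own \<open>\<psi>\<close> gives a contradiction.
\<close>

section \<open>Coloured points\<close>

text \<open>The formulas used here never force a world to hold a single point of some colour. So
  \<open>Dup\<close> offers an escape, which is harmless because the extraction evaluates a clause
  at a world with exactly one point of each universal colour, where the escape is closed. Variables
  are colours, so an atom read at one tuple of colours says nothing at another; the name sort and
  the hops repair this, and moving the widest tuple, of length 7, fixes the number 21 of ordinary
  sorts. The extracted relations need not be functional either, so the clauses for programs only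
  lead from a value back to its justification: each is the inversion of an evaluation rule. The
  diagonal argument needs no universal function and no recursion theorem, because the formula of a
  program is fixed before its input and the program merely builds a code around the number that it
  receives.\<close>

fun msat :: "(nat \<Rightarrow> nat set set) \<Rightarrow> nat set \<Rightarrow> fm \<Rightarrow> bool" where
  "msat V w (Atom p) \<longleftrightarrow> w \<in> V p"
| "msat V w Bot \<longleftrightarrow> False"
| "msat V w (Imp \<phi> \<psi>) \<longleftrightarrow> (msat V w \<phi> \<longrightarrow> msat V w \<psi>)"
| "msat V w (Box \<phi>) \<longleftrightarrow> (\<forall>v. v \<subseteq> w \<longrightarrow> v \<noteq> {} \<longrightarrow> msat V v \<phi>)"

lemma sat_medvedev_frame:
  "w \<subseteq> {..<n} \<Longrightarrow> w \<noteq> {} \<Longrightarrow> sat (medvedev_frame n) V w \<phi> \<longleftrightarrow> msat V w \<phi>"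
proof (induction \<phi> arbitrary: w)
  case (Box \<phi>)
  have "(\<forall>v\<in>fst (medvedev_frame n). (w, v) \<in> snd (medvedev_frame n) \<longrightarrow> sat (medvedev_frame n) V v \<phi>)
    \<longleftrightarrow> (\<forall>v. v \<subseteq> w \<longrightarrow> v \<noteq> {} \<longrightarrow> sat (medvedev_frame n) V v \<phi>)"
    using Box.prems by (auto simp: medvedev_frame_def Let_def)
  moreover have "v \<subseteq> w \<Longrightarrow> v \<noteq> {} \<Longrightarrow> sat (medvedev_frame n) V v \<phi> = msat V v \<phi>" for v
    using Box.prems by (intro Box.IH) auto
  ultimately show ?case by simp
qed auto

text \<open>\<open>valid\<close> admits only valuations into the worlds of the frame; truth at
  \<open>w\<close> consults nothing else, so arbitrary valuations may be used from here on.\<close>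

lemma msat_restrict:
  "w \<subseteq> U \<Longrightarrow> w \<noteq> {} \<Longrightarrow> msat (\<lambda>p. V p \<inter> (Pow U - {{}})) w \<phi> \<longleftrightarrow> msat V w \<phi>"
proof (induction \<phi> arbitrary: w)
  case (Box \<phi>)
  have "v \<subseteq> w \<Longrightarrow> v \<noteq> {} \<Longrightarrow> msat (\<lambda>p. V p \<inter> (Pow U - {{}})) v \<phi> \<longleftrightarrow> msat V v \<phi>" for v
    using Box.prems by (intro Box.IH) auto
  then show ?case by simp
qed auto

lemma not_in_MLBox_iff:
  "\<phi> \<notin> MLBox \<longleftrightarrow> (\<exists>V w. finite w \<and> w \<noteq> {} \<and> \<not> msat V w \<phi>)"
proof
  assume "\<phi> \<notin> MLBox"
  then obtain n V w where *: "w \<in> fst (medvedev_frame n)" "\<not> sat (medvedev_frame n) V w \<phi>"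
    by (auto simp: MLBox_def valid_def)
  then have w: "w \<subseteq> {..<n}" "w \<noteq> {}" by (auto simp: medvedev_frame_def Let_def)
  with * show "\<exists>V w. finite w \<and> w \<noteq> {} \<and> \<not> msat V w \<phi>"
    by (metis finite_lessThan finite_subset sat_medvedev_frame)
next
  assume "\<exists>V w. finite w \<and> w \<noteq> {} \<and> \<not> msat V w \<phi>"
  then obtain V w where w: "finite w" "w \<noteq> {}" "\<not> msat V w \<phi>" by blast
  then obtain n where n: "w \<subseteq> {..<n}"
    unfolding finite_nat_set_iff_bounded by auto
  let ?V = "\<lambda>p. V p \<inter> (Pow {..<n} - {{}})"
  have "\<not> sat (medvedev_frame n) ?V w \<phi>"
    using w n by (simp add: sat_medvedev_frame msat_restrict)
  moreover have "w \<in> fst (medvedev_frame n)" "\<forall>p. ?V p \<subseteq> fst (medvedev_frame n)"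
    using w n by (auto simp: medvedev_frame_def Let_def)
  moreover have "(\<forall>p. ?V p \<subseteq> fst (medvedev_frame n)) \<longrightarrow>
      (\<forall>w\<in>fst (medvedev_frame n). sat (medvedev_frame n) ?V w \<phi>)" if "\<phi> \<in> MLBox"
    using that unfolding MLBox_def valid_def mem_Collect_eq by (elim allE[of _ n] allE[of _ ?V])
  ultimately show "\<phi> \<notin> MLBox" by blast
qed

definition Neg :: "fm \<Rightarrow> fm" where "Neg \<phi> = Imp \<phi> Bot"
definition Dia :: "fm \<Rightarrow> fm" where "Dia \<phi> = Neg (Box (Neg \<phi>))"
definition Conj :: "fm \<Rightarrow> fm \<Rightarrow> fm" where "Conj \<phi> \<psi> = Neg (Imp \<phi> (Neg \<psi>))"
definition Disj :: "fm \<Rightarrow> fm \<Rightarrow> fm" where "Disj \<phi> \<psi> = Imp (Neg \<phi>) \<psi>"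
definition conjs :: "fm list \<Rightarrow> fm" where "conjs \<phi>s = foldr Conj \<phi>s (Neg Bot)"
definition disjs :: "fm list \<Rightarrow> fm" where "disjs \<phi>s = foldr Disj \<phi>s Bot"

lemma msat_connectives [simp]:
  "msat V w (Neg \<phi>) \<longleftrightarrow> \<not> msat V w \<phi>"
  "msat V w (Dia \<phi>) \<longleftrightarrow> (\<exists>v. v \<subseteq> w \<and> v \<noteq> {} \<and> msat V v \<phi>)"
  "msat V w (Conj \<phi> \<psi>) \<longleftrightarrow> msat V w \<phi> \<and> msat V w \<psi>"
  "msat V w (Disj \<phi> \<psi>) \<longleftrightarrow> msat V w \<phi> \<or> msat V w \<psi>"
  by (auto simp: Neg_def Dia_def Conj_def Disj_def)

lemma msat_conjs [simp]: "msat V w (conjs \<phi>s) \<longleftrightarrow> (\<forall>\<phi>\<in>set \<phi>s. msat V w \<phi>)"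
  by (induction \<phi>s) (auto simp: conjs_def)

lemma msat_disjs [simp]: "msat V w (disjs \<phi>s) \<longleftrightarrow> (\<exists>\<phi>\<in>set \<phi>s. msat V w \<phi>)"
  by (induction \<phi>s) (auto simp: disjs_def)

section \<open>Symbols, labels and the shape of clauses\<close>

instance recf :: countable by countable_datatype

text \<open>The conclusion of a clause is a disjunction. To assert several atoms about common
  witnesses, the witnesses are collected in one tuple of an auxiliary relation (\<open>RWS\<close>,
  \<open>RSt\<close>, \<open>RCm\<close>, \<open>RGC\<close>, \<open>RPR\<close>,
  \<open>RMuA\<close>, \<open>RGMA\<close>), from which further clauses derive the atoms one by
  one.\<close>

datatype rel_sym = RName | RZ | RS | RLt | RNil | RCons | RSame | RW | RWS | RInp | RSt
  | RG recf | RGL "recf list" | RGM recf | RCm recf "recf list" | RGC recf "recf list"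
  | RPR recf recf | RMuA recf | RGMA recf

instance rel_sym :: countable by countable_datatype

datatype label = Col nat | Full nat | Dup | Rel rel_sym "nat list"

instance label :: countable by countable_datatype

text \<open>The tags 0 and 1 are reserved for the input atoms \<open>chA\<close> and
  \<open>chB\<close>. Labels enter the input formulas as constants, so no computability of
  \<open>to_nat\<close> is involved.\<close>

definition ix :: "label \<Rightarrow> nat" where "ix l = prod_encode (2, to_nat l)"

abbreviation lab :: "label \<Rightarrow> fm" where "lab l \<equiv> Atom (ix l)"

type_synonym atm = "rel_sym \<times> nat list"

text \<open>In a frame of non-empty sets a formula of the shape \<open>\<box>(\<dots> \<longrightarrow> \<dots>)\<close> speaks about the union of
  any choice of points. The points are coloured by sorts, which play the role of variables. The formula
  \<open>clause_fm S E as cs\<close> expresses the clause \<open>\<forall>S. \<And>as \<longrightarrow> (\<exists>E. \<Or>cs)\<close>: in the antecedent \<open>Full i\<close> supplies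
  all candidates for the existential variable \<open>i\<close>, and the disjuncts with \<open>Dup\<close> discard the sets that
  contain two points of a universal sort.\<close>

definition clause_fm :: "nat list \<Rightarrow> nat list \<Rightarrow> atm list \<Rightarrow> atm list \<Rightarrow> fm" where
  "clause_fm S E as cs = Box (Imp
     (conjs (map (\<lambda>i. Dia (lab (Col i))) S @ map (\<lambda>i. Dia (lab (Full i))) E
       @ map (\<lambda>(q, is). Dia (lab (Rel q is))) as))
     (disjs (map (\<lambda>i. Dia (Conj (lab (Col i)) (lab Dup))) S
       @ map (\<lambda>(q, is). Dia (lab (Rel q is))) cs)))"

text \<open>The formula for \<open>Dup\<close> only says that \<open>Dup\<close> fails at every singleton, which is all that the
  extraction of a structure needs. It does not force \<open>Dup\<close> at larger sets.\<close>

definition frame_fms :: "nat \<Rightarrow> atm set \<Rightarrow> fm set" where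
  "frame_fms K Lb =
     (\<lambda>i. Box (Imp (lab (Col i)) (Box (lab (Col i))))) ` {..K}
   \<union> (\<lambda>(i, j). Box (Imp (lab (Col i)) (Neg (lab (Col j))))) ` ({..K} \<times> {..K} - Id)
   \<union> {Box (Imp (lab Dup) (Dia (Neg (lab Dup))))}
   \<union> (\<lambda>i. Dia (lab (Full i))) ` {..K}
   \<union> (\<lambda>i. Box (Imp (lab (Full i)) (lab (Col i)))) ` {..K}
   \<union> (\<lambda>(q, is). Box (Imp (lab (Rel q is)) (conjs (map (\<lambda>i. Dia (lab (Col i))) is)))) ` Lb
   \<union> (\<lambda>(q, is). Box (Imp (lab (Rel q is))
        (Box (Imp (conjs (map (\<lambda>i. Dia (lab (Col i))) is)) (lab (Rel q is)))))) ` Lb"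

lemma finite_frame_fms: "finite Lb \<Longrightarrow> finite (frame_fms K Lb)"
  by (auto simp: frame_fms_def)

section \<open>Evaluating clauses in a coloured model\<close>

locale coloured_model =
  fixes V :: "nat \<Rightarrow> nat set set" and w :: "nat set" and K :: nat and Lb :: "atm set"
  assumes frame: "\<And>\<phi>. \<phi> \<in> frame_fms K Lb \<Longrightarrow> msat V w \<phi>"
begin

lemma col_down:
  assumes "i \<le> K" "y \<subseteq> w" "y \<in> V (ix (Col i))" "z \<subseteq> y" "z \<noteq> {}"
  shows "z \<in> V (ix (Col i))"
proof -
  have "msat V w (Box (Imp (lab (Col i)) (Box (lab (Col i)))))"
    using assms(1) by (intro frame) (auto simp: frame_fms_def)
  with assms(2-) show ?thesis by simp (metis subset_empty)
qed

lemma col_disjoint: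
  assumes "i \<le> K" "j \<le> K" "i \<noteq> j" "y \<subseteq> w" "y \<noteq> {}" "y \<in> V (ix (Col i))"
  shows "y \<notin> V (ix (Col j))"
proof -
  have "msat V w (Box (Imp (lab (Col i)) (Neg (lab (Col j)))))"
    using assms(1-3) by (intro frame) (auto simp: frame_fms_def)
  with assms(4-) show ?thesis by simp
qed

text \<open>The only non-empty subset of a singleton is the singleton itself, so \<open>Dup\<close>
  there would have to fail there.\<close>

lemma not_dup_singleton: "p \<in> w \<Longrightarrow> {p} \<notin> V (ix Dup)"
proof -
  assume "p \<in> w"
  have "msat V w (Box (Imp (lab Dup) (Dia (Neg (lab Dup)))))"
    by (intro frame) (auto simp: frame_fms_def)
  then show ?thesis using \<open>p \<in> w\<close>
    by simp (metis bot_least empty_not_insert insert_subset subset_singletonD)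
qed

lemma full_exists:
  assumes "i \<le> K"
  obtains F where "F \<subseteq> w" "F \<noteq> {}" "F \<in> V (ix (Full i))" "F \<in> V (ix (Col i))"
proof -
  have "msat V w (Dia (lab (Full i)))"
    using assms by (intro frame) (simp add: frame_fms_def)
  then obtain F where F: "F \<subseteq> w" "F \<noteq> {}" "F \<in> V (ix (Full i))" by auto
  have "msat V w (Box (Imp (lab (Full i)) (lab (Col i))))"
    using assms by (intro frame) (simp add: frame_fms_def)
  with F have "F \<in> V (ix (Col i))" by simp
  with F show ?thesis by (rule that)
qed

lemma rel_col:
  assumes "(q, is) \<in> Lb" "y \<subseteq> w" "y \<noteq> {}" "y \<in> V (ix (Rel q is))" "i \<in> set is"
  shows "\<exists>z. z \<subseteq> y \<and> z \<noteq> {} \<and> z \<in> V (ix (Col i))"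
proof -
  have "msat V w (Box (Imp (lab (Rel q is)) (conjs (map (\<lambda>i. Dia (lab (Col i))) is))))"
    using assms(1) by (intro frame) (force simp: frame_fms_def)
  with assms(2-) show ?thesis by simp
qed

lemma rel_down:
  assumes "(q, is) \<in> Lb" "y \<subseteq> w" "y \<in> V (ix (Rel q is))" "z \<subseteq> y" "z \<noteq> {}"
    and "\<And>i. i \<in> set is \<Longrightarrow> \<exists>u. u \<subseteq> z \<and> u \<noteq> {} \<and> u \<in> V (ix (Col i))"
  shows "z \<in> V (ix (Rel q is))"
proof -
  have "msat V w (Box (Imp (lab (Rel q is))
        (Box (Imp (conjs (map (\<lambda>i. Dia (lab (Col i))) is)) (lab (Rel q is))))))"
    using assms(1) by (intro frame) (force simp: frame_fms_def)
  with assms(2-) show ?thesis by simp (metis subset_empty)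
qed

definition pt :: "nat \<Rightarrow> nat \<Rightarrow> bool" where
  "pt i p \<longleftrightarrow> p \<in> w \<and> {p} \<in> V (ix (Col i))"

lemma pt_in: "i \<le> K \<Longrightarrow> y \<subseteq> w \<Longrightarrow> y \<in> V (ix (Col i)) \<Longrightarrow> p \<in> y \<Longrightarrow> pt i p"
  unfolding pt_def by (auto intro: col_down)

lemma pt_unique: "i \<le> K \<Longrightarrow> j \<le> K \<Longrightarrow> pt i p \<Longrightarrow> pt j p \<Longrightarrow> i = j"
  unfolding pt_def using col_disjoint[of i j "{p}"] by auto

lemma pt_exists: "i \<le> K \<Longrightarrow> \<exists>p. pt i p"
  by (metis all_not_in_conv full_exists pt_in)

text \<open>The clause formula is evaluated at the points \<open>a i\<close> together with one
  \<open>Full\<close> set for each existential sort. Sorts are disjoint, so this world has a single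
  point of each universal sort and the \<open>Dup\<close> disjuncts fail. Some label of
  \<open>cs\<close> then holds below it, and \<open>rel_down\<close> cuts that set down to one point
  per sort.\<close>

lemma clause_sound:
  assumes sat: "msat V w (clause_fm S E as cs)"
    and S: "S \<noteq> []" "set S \<subseteq> {..K}" "set E \<subseteq> {..K}" "set S \<inter> set E = {}"
    and as: "\<And>q is. (q, is) \<in> set as \<Longrightarrow> set is \<subseteq> set S \<and> is \<noteq> []"
    and cs: "\<And>q is. (q, is) \<in> set cs \<Longrightarrow> (q, is) \<in> Lb \<and> set is \<subseteq> set S \<union> set E \<and> is \<noteq> []"
    and a: "\<And>i. i \<in> set S \<Longrightarrow> pt i (a i)"
    and ants: "\<And>q is. (q, is) \<in> set as \<Longrightarrow> a ` set is \<in> V (ix (Rel q is))"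
  shows "\<exists>q is a'. (q, is) \<in> set cs \<and> (\<forall>i\<in>set S. a' i = a i) \<and> (\<forall>i\<in>set is. pt i (a' i))
    \<and> a' ` set is \<in> V (ix (Rel q is))"
proof -
  have "\<exists>F. \<forall>i\<in>set E. F i \<subseteq> w \<and> F i \<noteq> {} \<and> F i \<in> V (ix (Full i)) \<and> F i \<in> V (ix (Col i))"
    using S(3) by (intro bchoice) (metis atMost_iff full_exists subsetD)
  then obtain F where F: "\<And>i. i \<in> set E \<Longrightarrow> F i \<subseteq> w \<and> F i \<noteq> {} \<and> F i \<in> V (ix (Full i)) \<and> F i \<in> V (ix (Col i))"
    by blast
  define y where "y = a ` set S \<union> (\<Union>i\<in>set E. F i)"
  have yw: "y \<subseteq> w" using a F by (auto simp: y_def pt_def)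
  have yne: "y \<noteq> {}" using S(1) by (auto simp: y_def)
  have y_pt: "p = a i" if "i \<in> set S" "p \<in> y" "pt i p" for i p
  proof -
    have "i \<le> K" using that S by auto
    from that(2) consider j where "j \<in> set S" "p = a j" | j where "j \<in> set E" "p \<in> F j"
      by (auto simp: y_def)
    then show ?thesis
    proof cases
      case 1
      then have "pt j p" "j \<le> K" using a S by auto
      with \<open>i \<le> K\<close> that(3) 1 show ?thesis using pt_unique by blast
    next
      case 2
      then have "j \<le> K" using S by auto
      with 2 F have "pt j p" by (meson pt_in)
      with \<open>i \<le> K\<close> \<open>j \<le> K\<close> that(3) have "i = j" using pt_unique by blast
      with 2 that(1) S(4) show ?thesis by auto
    qed
  qed
  have prem: "msat V y (conjs (map (\<lambda>i. Dia (lab (Col i))) S @ map (\<lambda>i. Dia (lab (Full i))) E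
       @ map (\<lambda>(q, is). Dia (lab (Rel q is))) as))"
  proof -
    have "\<exists>v\<subseteq>y. v \<noteq> {} \<and> v \<in> V (ix (Col i))" if "i \<in> set S" for i
      using that a by (intro exI[of _ "{a i}"]) (auto simp: y_def pt_def)
    moreover have "\<exists>v\<subseteq>y. v \<noteq> {} \<and> v \<in> V (ix (Full i))" if "i \<in> set E" for i
      using that F by (intro exI[of _ "F i"]) (auto simp: y_def)
    moreover have "\<exists>v\<subseteq>y. v \<noteq> {} \<and> v \<in> V (ix (Rel q is))" if "(q, is) \<in> set as" for q "is"
      using that as ants by (intro exI[of _ "a ` set is"]) (force simp: y_def)
    ultimately show ?thesis by auto
  qed
  have nodup: "\<not> (\<exists>v\<subseteq>y. v \<noteq> {} \<and> v \<in> V (ix (Col i)) \<and> v \<in> V (ix Dup))" if i: "i \<in> set S" for i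
  proof
    assume "\<exists>v\<subseteq>y. v \<noteq> {} \<and> v \<in> V (ix (Col i)) \<and> v \<in> V (ix Dup)"
    then obtain v where v: "v \<subseteq> y" "v \<noteq> {}" "v \<in> V (ix (Col i))" "v \<in> V (ix Dup)" by blast
    have "p = a i" if "p \<in> v" for p
    proof (rule y_pt[OF i])
      show "p \<in> y" using that v by auto
      have "i \<le> K" "v \<subseteq> w" using i S v yw by auto
      then show "pt i p" using pt_in v that by blast
    qed
    \<comment> \<open>A subset of one universal colour is a singleton, where \<open>Dup\<close> is
      excluded.\<close>
    with v(2) have "v = {a i}" by blast
    with v i a not_dup_singleton show False by (auto simp: pt_def)
  qed
  from sat prem yw yne have "msat V y (disjs (map (\<lambda>i. Dia (Conj (lab (Col i)) (lab Dup))) S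
       @ map (\<lambda>(q, is). Dia (lab (Rel q is))) cs))"
    unfolding clause_fm_def by simp
  then have "(\<exists>i\<in>set S. \<exists>v\<subseteq>y. v \<noteq> {} \<and> v \<in> V (ix (Col i)) \<and> v \<in> V (ix Dup))
      \<or> (\<exists>x\<in>set cs. \<exists>v\<subseteq>y. v \<noteq> {} \<and> v \<in> V (ix (Rel (fst x) (snd x))))"
    by (simp add: bex_Un case_prod_unfold)
  with nodup have "\<exists>x\<in>set cs. \<exists>v\<subseteq>y. v \<noteq> {} \<and> v \<in> V (ix (Rel (fst x) (snd x)))"
    by blast
  then obtain q "is" v where q: "(q, is) \<in> set cs" "v \<subseteq> y" "v \<noteq> {}" "v \<in> V (ix (Rel q is))"
    by (metis prod.collapse)
  have Lb: "(q, is) \<in> Lb" "set is \<subseteq> {..K}" "is \<noteq> []" "set is \<subseteq> set S \<union> set E"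
    using cs[OF q(1)] S by auto
  have "\<exists>p\<in>v. pt i p" if i: "i \<in> set is" for i
  proof -
    from rel_col[OF Lb(1) _ q(3,4) i] yw q(2) obtain z where "z \<subseteq> v" "z \<noteq> {}" "z \<in> V (ix (Col i))"
      by auto
    moreover have "i \<le> K" using i Lb by auto
    moreover have "z \<subseteq> w" using \<open>z \<subseteq> v\<close> q(2) yw by auto
    ultimately show ?thesis using pt_in by blast
  qed
  then obtain b where b: "\<And>i. i \<in> set is \<Longrightarrow> b i \<in> v \<and> pt i (b i)" by metis
  \<comment> \<open>Universal sorts keep their points even if the disjunct does not mention them;
    the other sorts of the disjunct take any of their points in \<open>v\<close>.\<close>
  define a' where "a' i = (if i \<in> set S then a i else b i)" for i
  have a'b: "a' i = b i" if "i \<in> set is" for i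
    using b[OF that] y_pt[of i "b i"] q(2) by (auto simp: a'_def)
  have sub: "a' ` set is \<subseteq> v" using a'b b by auto
  have "a' ` set is \<in> V (ix (Rel q is))"
  proof (rule rel_down[OF Lb(1) _ q(4) sub])
    show "v \<subseteq> w" using q yw by auto
    show "a' ` set is \<noteq> {}" using Lb by auto
    fix i assume i: "i \<in> set is"
    then show "\<exists>u\<subseteq>a' ` set is. u \<noteq> {} \<and> u \<in> V (ix (Col i))"
      using b[OF i] a'b[OF i] by (intro exI[of _ "{a' i}"]) (simp add: pt_def image_iff, metis)
  qed
  with q(1) a'b b show ?thesis by (intro exI[of _ q] exI[of _ "is"] exI[of _ a']) (auto simp: a'_def)
qed

end

section \<open>The intended models\<close>

definition sorted_clause_true :: "'a set \<Rightarrow> (rel_sym \<Rightarrow> 'a list set) \<Rightarrow>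
    nat list \<Rightarrow> nat list \<Rightarrow> atm list \<Rightarrow> atm list \<Rightarrow> bool" where
  "sorted_clause_true A I S E as cs \<longleftrightarrow>
    (\<forall>v. (\<forall>i\<in>set S. v i \<in> A) \<longrightarrow> (\<forall>(q, is)\<in>set as. map v is \<in> I q) \<longrightarrow>
      (\<exists>v'. (\<forall>i\<in>set S. v' i = v i) \<and> (\<forall>i\<in>set E. v' i \<in> A)
        \<and> (\<exists>(q, is)\<in>set cs. map v' is \<in> I q)))"

locale intended_model =
  fixes A :: "'a::countable set" and I :: "rel_sym \<Rightarrow> 'a list set" and K :: nat and c :: "nat \<Rightarrow> 'a"
  assumes finA: "finite A" and neA: "A \<noteq> {}" and K: "0 < K"
begin

text \<open>The copy of \<open>x\<close> in sort \<open>i\<close>; division with remainder by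
  \<open>Suc K\<close> recovers both.\<close>

definition pnt :: "nat \<Rightarrow> 'a \<Rightarrow> nat" where
  "pnt i x = to_nat x * Suc K + i"

lemma pnt_inject:
  assumes "i \<le> K" "j \<le> K"
  shows "pnt i x = pnt j y \<longleftrightarrow> i = j \<and> x = y"
proof -
  have "pnt i x mod Suc K = i \<and> pnt i x div Suc K = to_nat x" if "i \<le> K" for i and x :: 'a
    using that by (simp add: pnt_def del: mult_Suc_right)
  then show ?thesis using assms by (metis from_nat_to_nat)
qed

definition root :: "nat set" where
  "root = (\<Union>i\<le>K. pnt i ` A)"

text \<open>\<open>Dup\<close> gets the largest valuation that its formula permits. A relation holds
  exactly at the sets made of one copy of each argument, in the sorts listed by the label.\<close>

fun label_val :: "label \<Rightarrow> nat set \<Rightarrow> bool" where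
  "label_val (Col i) y \<longleftrightarrow> y \<subseteq> pnt i ` A"
| "label_val (Full i) y \<longleftrightarrow> y = pnt i ` A"
| "label_val Dup y \<longleftrightarrow> (\<forall>p. y \<noteq> {p})"
| "label_val (Rel q is) y \<longleftrightarrow>
    (\<exists>v. y = (\<lambda>i. pnt i (v i)) ` set is \<and> (\<forall>i\<in>set is. v i \<in> A) \<and> map v is \<in> I q)"

text \<open>Both input atoms for \<open>k\<close> denote the same element \<open>c k\<close>, once
  in sort 0 and once in sort 1.\<close>

definition val :: "nat \<Rightarrow> nat set set" where
  "val p = (case prod_decode p of (s, k) \<Rightarrow>
     if s = 0 then {{pnt 0 (c k)}} else if s = 1 then {{pnt 1 (c k)}}
     else {y. y \<noteq> {} \<and> label_val (from_nat k) y})"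

lemma val_ix [simp]: "y \<in> val (ix l) \<longleftrightarrow> y \<noteq> {} \<and> label_val l y"
  by (simp add: val_def ix_def)

lemma finite_root: "finite root" and root_nonempty: "root \<noteq> {}"
  using finA neA by (auto simp: root_def)

lemma frame_fms_true:
  assumes Lb: "\<And>q is. (q, is) \<in> Lb \<Longrightarrow> set is \<subseteq> {..K}"
    and \<phi>: "\<phi> \<in> frame_fms K Lb"
  shows "msat val root \<phi>"
  using \<phi> unfolding frame_fms_def
proof (elim UnE)
  assume "\<phi> \<in> (\<lambda>i. Box (Imp (lab (Col i)) (Box (lab (Col i))))) ` {..K}"
  then show ?thesis by clarsimp (meson subsetD)
next
  assume "\<phi> \<in> (\<lambda>(i, j). Box (Imp (lab (Col i)) (Neg (lab (Col j))))) ` ({..K} \<times> {..K} - Id)"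
  then obtain i j where *: "\<phi> = Box (Imp (lab (Col i)) (Neg (lab (Col j))))" "i \<le> K" "j \<le> K" "i \<noteq> j"
    by auto
  have "pnt i ` A \<inter> pnt j ` A = {}" using * pnt_inject by auto
  then show ?thesis unfolding * by auto
next
  assume *: "\<phi> \<in> {Box (Imp (lab Dup) (Dia (Neg (lab Dup))))}"
  have "\<exists>v\<subseteq>y. v \<noteq> {} \<and> (\<exists>p. v = {p})" if "y \<noteq> {}" for y :: "nat set"
    using that by (metis bot_least empty_not_insert ex_in_conv insert_subset)
  then show ?thesis using * by auto
next
  assume "\<phi> \<in> (\<lambda>i. Dia (lab (Full i))) ` {..K}"
  then obtain i where *: "\<phi> = Dia (lab (Full i))" "i \<le> K" by auto
  then have "pnt i ` A \<subseteq> root" by (auto simp: root_def)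
  then show ?thesis using neA * by (auto simp: image_iff)
next
  assume "\<phi> \<in> (\<lambda>i. Box (Imp (lab (Full i)) (lab (Col i)))) ` {..K}"
  then show ?thesis by auto
next
  assume "\<phi> \<in> (\<lambda>(q, is). Box (Imp (lab (Rel q is)) (conjs (map (\<lambda>i. Dia (lab (Col i))) is)))) ` Lb"
  then obtain q "is" where *: "\<phi> = Box (Imp (lab (Rel q is)) (conjs (map (\<lambda>i. Dia (lab (Col i))) is)))"
    "(q, is) \<in> Lb" by auto
  have "\<exists>v\<subseteq>y. v \<noteq> {} \<and> label_val (Col i) v" if "label_val (Rel q is) y" "i \<in> set is" for y i
  proof -
    from that obtain v where "y = (\<lambda>i. pnt i (v i)) ` set is" "\<forall>i\<in>set is. v i \<in> A" by auto
    with that(2) show ?thesis by (intro exI[of _ "{pnt i (v i)}"]) auto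
  qed
  then show ?thesis unfolding * by (simp del: label_val.simps)
next
  assume "\<phi> \<in> (\<lambda>(q, is). Box (Imp (lab (Rel q is))
        (Box (Imp (conjs (map (\<lambda>i. Dia (lab (Col i))) is)) (lab (Rel q is)))))) ` Lb"
  then obtain q "is" where *: "\<phi> = Box (Imp (lab (Rel q is))
        (Box (Imp (conjs (map (\<lambda>i. Dia (lab (Col i))) is)) (lab (Rel q is)))))"
    "(q, is) \<in> Lb" by auto
  \<comment> \<open>A tuple set has one point per sort, so a part of it that still meets every sort
    of the label is the whole set.\<close>
  have "label_val (Rel q is) z"
    if y: "label_val (Rel q is) y" and z: "z \<subseteq> y"
      and col: "\<And>i. i \<in> set is \<Longrightarrow> \<exists>u\<subseteq>z. u \<noteq> {} \<and> label_val (Col i) u" for y z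
  proof -
    from y obtain v where v: "y = (\<lambda>i. pnt i (v i)) ` set is" "\<forall>i\<in>set is. v i \<in> A" by auto
    have "pnt i (v i) \<in> z" if i: "i \<in> set is" for i
    proof -
      from col[OF i] obtain x where x: "pnt i x \<in> z" by auto
      with z v obtain j where j: "j \<in> set is" "pnt i x = pnt j (v j)" by auto
      have "i \<le> K" "j \<le> K" using Lb[OF *(2)] i j by auto
      with j x show ?thesis by (metis pnt_inject)
    qed
    with z v have "z = y" by blast
    with y show ?thesis by simp
  qed
  then show ?thesis unfolding * by (simp del: label_val.simps)
qed

text \<open>Either two points share a universal sort and a \<open>Dup\<close> disjunct holds, or the
  world determines an assignment of the universal variables. In the second case the existential
  sorts lie in the world as a whole, so it contains the copies of whatever witnesses the clause
  provides.\<close>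

lemma clause_fm_true:
  assumes S: "set S \<subseteq> {..K}" "set E \<subseteq> {..K}"
    and as: "\<And>q is. (q, is) \<in> set as \<Longrightarrow> set is \<subseteq> set S"
    and cs: "\<And>q is. (q, is) \<in> set cs \<Longrightarrow> set is \<subseteq> set S \<union> set E \<and> is \<noteq> []"
    and true: "sorted_clause_true A I S E as cs"
  shows "msat val root (clause_fm S E as cs)"
proof -
  have "msat val y (disjs (map (\<lambda>i. Dia (Conj (lab (Col i)) (lab Dup))) S
       @ map (\<lambda>(q, is). Dia (lab (Rel q is))) cs))"
    if "y \<subseteq> root" and
     prem: "msat val y (conjs (map (\<lambda>i. Dia (lab (Col i))) S @ map (\<lambda>i. Dia (lab (Full i))) E
       @ map (\<lambda>(q, is). Dia (lab (Rel q is))) as))" for y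
  proof (cases "\<exists>i\<in>set S. \<exists>u\<subseteq>y. u \<noteq> {} \<and> label_val (Col i) u \<and> label_val Dup u")
    case True
    then obtain i u where "i \<in> set S" "u \<subseteq> y" "u \<noteq> {}" "label_val (Col i) u" "label_val Dup u"
      by blast
    then have "msat val y (Dia (Conj (lab (Col i)) (lab Dup)))"
      by (auto simp del: label_val.simps)
    with \<open>i \<in> set S\<close> show ?thesis unfolding msat_disjs
      by (intro bexI[of _ "Dia (Conj (lab (Col i)) (lab Dup))"]) (simp_all del: msat_connectives)
  next
    case False
    from prem have prem_S: "\<forall>i\<in>set S. \<exists>u\<subseteq>y. u \<noteq> {} \<and> label_val (Col i) u"
      and prem_E: "\<forall>i\<in>set E. \<exists>u\<subseteq>y. u \<noteq> {} \<and> label_val (Full i) u"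
      and prem_as: "\<forall>x\<in>set as. \<exists>u\<subseteq>y. u \<noteq> {} \<and> label_val (Rel (fst x) (snd x)) u"
      by (simp_all add: ball_Un case_prod_unfold del: label_val.simps)
    have "\<exists>x\<in>A. pnt i x \<in> y" if "i \<in> set S" for i
    proof -
      from prem_S that obtain u where "u \<subseteq> y" "u \<noteq> {}" "label_val (Col i) u"
        by blast
      then show ?thesis by auto
    qed
    then obtain v where v: "\<And>i. i \<in> set S \<Longrightarrow> v i \<in> A \<and> pnt i (v i) \<in> y" by metis
    have uniq: "x = v i" if i: "i \<in> set S" "x \<in> A" "pnt i x \<in> y" for i x
    proof (rule ccontr)
      assume "x \<noteq> v i"
      then have "pnt i x \<noteq> pnt i (v i)" using i S pnt_inject by auto
      then have "label_val (Col i) {pnt i x, pnt i (v i)}" "label_val Dup {pnt i x, pnt i (v i)}"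
        using i v by auto
      moreover have "{pnt i x, pnt i (v i)} \<subseteq> y" using i v by auto
      ultimately show False using False i by blast
    qed
    have "map v is \<in> I q" if q: "(q, is) \<in> set as" for q "is"
    proof -
      from prem_as q obtain u where u: "u \<subseteq> y" "label_val (Rel q is) u"
        by (metis fst_conv snd_conv)
      then obtain v' where v': "u = (\<lambda>i. pnt i (v' i)) ` set is" "\<forall>i\<in>set is. v' i \<in> A" "map v' is \<in> I q"
        by auto
      \<comment> \<open>The set that makes the antecedent true lies in \<open>y\<close>, where a
        universal sort has no other point.\<close>
      have "v' i = v i" if i: "i \<in> set is" for i
        using uniq[of i "v' i"] as[OF q] i v' u by auto
      then have "map v' is = map v is" by simp
      with v' show ?thesis by simp
    qed
    then have "\<forall>(q, is)\<in>set as. map v is \<in> I q" by blast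
    moreover have "\<forall>i\<in>set S. v i \<in> A" using v by blast
    ultimately have "\<exists>v'. (\<forall>i\<in>set S. v' i = v i) \<and> (\<forall>i\<in>set E. v' i \<in> A)
        \<and> (\<exists>(q, is)\<in>set cs. map v' is \<in> I q)"
      using true[unfolded sorted_clause_true_def, THEN spec, of v] by (elim impE)
    then obtain v' x where v'x: "\<forall>i\<in>set S. v' i = v i" "\<forall>i\<in>set E. v' i \<in> A"
      "x \<in> set cs" "case x of (q, is) \<Rightarrow> map v' is \<in> I q"
      unfolding bex_simps(6) by (elim exE conjE bexE)
    obtain q "is" where "x = (q, is)" by (cases x)
    with v'x have v': "\<forall>i\<in>set S. v' i = v i" "\<forall>i\<in>set E. v' i \<in> A"
      "(q, is) \<in> set cs" "map v' is \<in> I q" by auto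
    have full: "pnt i (v' i) \<in> y" if i: "i \<in> set E" for i
    proof -
      from prem_E i obtain u where "u \<subseteq> y" "label_val (Full i) u"
        by blast
      then show ?thesis using v' i by auto
    qed
    have "(\<lambda>i. pnt i (v' i)) ` set is \<subseteq> y" using cs[OF v'(3)] v v' full by fastforce
    moreover have "\<forall>i\<in>set is. v' i \<in> A" using cs[OF v'(3)] v v' by fastforce
    then have "label_val (Rel q is) ((\<lambda>i. pnt i (v' i)) ` set is)" using v'(4) by auto
    moreover have "(\<lambda>i. pnt i (v' i)) ` set is \<noteq> {}" using cs[OF v'(3)] by simp
    ultimately have "msat val y (Dia (lab (Rel q is)))"
      by (auto simp del: label_val.simps)
    moreover have "Dia (lab (Rel q is)) \<in> set (map (\<lambda>(q, is). Dia (lab (Rel q is))) cs)"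
      using v'(3) by force
    ultimately show ?thesis unfolding msat_disjs set_append by blast
  qed
  then show ?thesis unfolding clause_fm_def by simp
qed

end

section \<open>From sorted to one-sorted structures\<close>

text \<open>In \<open>(k, l, as, cs)\<close> the variables below \<open>k\<close> are universal,
  those from \<open>k\<close> up to \<open>l\<close> existential; \<open>as\<close> is read as a
  conjunction and \<open>cs\<close> as a disjunction, so an empty \<open>cs\<close> makes a
  denial.\<close>

type_synonym clause = "nat \<times> nat \<times> atm list \<times> atm list"

fun holds :: "'a set \<Rightarrow> (rel_sym \<Rightarrow> 'a list set) \<Rightarrow> clause \<Rightarrow> bool" where
  "holds A I (k, l, as, cs) \<longleftrightarrow>
    (\<forall>xs. length xs = k \<longrightarrow> set xs \<subseteq> A \<longrightarrow> (\<forall>(q, is)\<in>set as. map ((!) xs) is \<in> I q) \<longrightarrow>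
      (\<exists>ys. length ys = l - k \<and> set ys \<subseteq> A \<and> (\<exists>(q, is)\<in>set cs. map ((!) (xs @ ys)) is \<in> I q)))"

fun arity :: "rel_sym \<Rightarrow> nat" where
  "arity RName = 2" | "arity RZ = 1" | "arity RS = 2" | "arity RLt = 2" | "arity RNil = 1"
| "arity RCons = 3" | "arity RSame = 2" | "arity RW = 1" | "arity RWS = 2" | "arity RInp = 1"
| "arity RSt = 4" | "arity (RG f) = 2" | "arity (RGL gs) = 2" | "arity (RGM f) = 1"
| "arity (RCm f gs) = 3" | "arity (RGC g gs) = 4" | "arity (RPR f g) = 7" | "arity (RMuA f) = 4"
| "arity (RGMA f) = 5"

text \<open>The bound \<open>3 * arity q\<close> is what moving a tuple to arbitrary sorts requires: the source, the target
  and an intermediate place disjoint from both.\<close>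

definition name_sort :: nat where "name_sort = 21"

lemma arity_bounds: "0 < arity q" "3 * arity q \<le> name_sort"
  by (cases q; simp add: name_sort_def)+

text \<open>Variables will be sorts and a world offers one relevant point per sort, whence the
  distinct arguments. \<open>RName\<close> is reserved for the link to the name sort.\<close>

definition wf_atm :: "nat \<Rightarrow> atm \<Rightarrow> bool" where
  "wf_atm l = (\<lambda>(q, is). q \<noteq> RName \<and> length is = arity q \<and> distinct is \<and> (\<forall>i\<in>set is. i < l))"

fun wf_clause :: "clause \<Rightarrow> bool" where
  "wf_clause (k, l, as, cs) \<longleftrightarrow>
    0 < k \<and> k \<le> l \<and> l \<le> name_sort \<and> (\<forall>x\<in>set as. wf_atm k x) \<and> (\<forall>x\<in>set cs. wf_atm l x)"

type_synonym sorted_clause = "nat list \<times> nat list \<times> atm list \<times> atm list"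

definition rel_labels :: "rel_sym set \<Rightarrow> atm set" where
  "rel_labels R = Sigma (R - {RName}) (\<lambda>q. {is. length is = arity q \<and> distinct is \<and> set is \<subseteq> {..<name_sort}})"

definition all_labels :: "rel_sym set \<Rightarrow> atm set" where
  "all_labels R = rel_labels R \<union> (\<lambda>i. (RName, [name_sort, i])) ` {..<name_sort}"

text \<open>The last sort consists of the elements of the structure to be extracted, and the points of the other
  sorts are copies of them. The hop clauses make the truth of a relation independent of the sorts and
  copies at which it is read off. A world holds at most one relevant point per sort, so one argument
  is moved at a time, to a sort not occupied by another argument.\<close>

definition name_clauses :: "sorted_clause set" where
  "name_clauses = (\<Union>i<name_sort. {([i], [name_sort], [], [(RName, [name_sort, i])]), ([name_sort], [i], [], [(RName, [name_sort, i])])})"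

definition hop_clauses :: "rel_sym set \<Rightarrow> sorted_clause set" where
  "hop_clauses R = (\<Union>(q, is)\<in>rel_labels R. \<Union>m<length is. \<Union>j\<in>{..<name_sort} - set is.
     {(name_sort # j # is, [], [(q, is), (RName, [name_sort, is ! m]), (RName, [name_sort, j])], [(q, is[m := j])])})"

definition sort_clause :: "clause \<Rightarrow> sorted_clause" where
  "sort_clause = (\<lambda>(k, l, as, cs). ([0..<k], [k..<l], as, cs))"

definition clause_syms :: "clause \<Rightarrow> rel_sym set" where
  "clause_syms = (\<lambda>(k, l, as, cs). fst ` (set as \<union> set cs))"

definition theory_fms :: "rel_sym set \<Rightarrow> clause set \<Rightarrow> fm set" where
  "theory_fms R C = frame_fms name_sort (all_labels R)
    \<union> (\<lambda>(S, E, as, cs). clause_fm S E as cs) ` (name_clauses \<union> hop_clauses R \<union> sort_clause ` C)"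

lemma finite_theory_fms:
  assumes "finite R" "finite C"
  shows "finite (theory_fms R C)"
proof -
  have "finite {is. length is = n \<and> distinct is \<and> set is \<subseteq> {..<name_sort}}" for n
    by (rule finite_subset[OF _ finite_lists_length_eq[of "{..<name_sort}" n]]) auto
  then have "finite (rel_labels R)" unfolding rel_labels_def using assms(1) by (intro finite_SigmaI) auto
  then show ?thesis using assms(2)
    unfolding theory_fms_def all_labels_def name_clauses_def hop_clauses_def
    by (auto intro!: finite_frame_fms split: prod.split)
qed

section \<open>Extracting a one-sorted structure from a model\<close>

locale theory_model =
  fixes V :: "nat \<Rightarrow> nat set set" and w :: "nat set" and R :: "rel_sym set" and C :: "clause set"
  assumes fin: "finite w"
    and thy: "\<And>\<phi>. \<phi> \<in> theory_fms R C \<Longrightarrow> msat V w \<phi>"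
    and wf: "\<And>c. c \<in> C \<Longrightarrow> wf_clause c"
    and syms: "\<And>c. c \<in> C \<Longrightarrow> clause_syms c \<subseteq> R"
begin

sublocale coloured_model V w name_sort "all_labels R"
  using thy by unfold_locales (auto simp: theory_fms_def)

text \<open>Neither side need determine the other: a name may have several copies in one sort, and a
  point several names.\<close>

definition clone :: "nat \<Rightarrow> nat \<Rightarrow> nat \<Rightarrow> bool" where
  "clone i x p \<longleftrightarrow> pt name_sort x \<and> pt i p \<and> {x, p} \<in> V (ix (Rel RName [name_sort, i]))"

lemma clone_exists:
  assumes "i < name_sort" "pt name_sort x"
  shows "\<exists>p. clone i x p"
proof -
  have "msat V w (clause_fm [name_sort] [i] [] [(RName, [name_sort, i])])"
    using assms by (intro thy) (force simp: theory_fms_def name_clauses_def)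
  then obtain a where "a name_sort = x" "pt name_sort (a name_sort)" "pt i (a i)" "a ` {name_sort, i} \<in> V (ix (Rel RName [name_sort, i]))"
    using clause_sound[of "[name_sort]" "[i]" "[]" "[(RName, [name_sort, i])]" "\<lambda>_. x"] assms
    by (auto simp: all_labels_def)
  then show ?thesis by (auto simp: clone_def)
qed

lemma name_exists:
  assumes "i < name_sort" "pt i p"
  shows "\<exists>x. clone i x p"
proof -
  have "msat V w (clause_fm [i] [name_sort] [] [(RName, [name_sort, i])])"
    using assms by (intro thy) (force simp: theory_fms_def name_clauses_def)
  then obtain a where "a i = p" "pt name_sort (a name_sort)" "pt i (a i)" "a ` {name_sort, i} \<in> V (ix (Rel RName [name_sort, i]))"
    using clause_sound[of "[i]" "[name_sort]" "[]" "[(RName, [name_sort, i])]" "\<lambda>_. p"] assms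
    by (auto simp: all_labels_def)
  then show ?thesis by (auto simp: clone_def)
qed

text \<open>The hop clause is used at the argument tuple, the new copy in sort \<open>j\<close> and
  the common name \<open>x\<close> of the old and the new copy. As \<open>j\<close> is not in use,
  the new copy does not clash with another argument.\<close>

lemma hop:
  assumes q: "(q, is) \<in> rel_labels R" "m < length is" "j < name_sort" "j \<notin> set is"
    and a: "\<And>i. i \<in> set is \<Longrightarrow> pt i (a i)"
    and R: "a ` set is \<in> V (ix (Rel q is))"
    and x: "clone (is ! m) x (a (is ! m))" "clone j x (a j)"
  shows "a ` set (is[m := j]) \<in> V (ix (Rel q (is[m := j])))"
proof -
  let ?S = "name_sort # j # is" and ?as = "[(q, is), (RName, [name_sort, is ! m]), (RName, [name_sort, j])]"
    and ?cs = "[(q, is[m := j])]"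
  have facts: "is \<noteq> []" "set is \<subseteq> {..<name_sort}" "distinct is" "is ! m \<in> set is"
    using q by (auto simp: rel_labels_def)
  then have K: "name_sort \<notin> set is" by auto
  \<comment> \<open>The name sort occurs neither in \<open>is\<close> nor as \<open>j\<close>, so
    placing \<open>x\<close> there leaves the tuple and the new copy alone.\<close>
  define a' where "a' = a(name_sort := x)"
  have sub: "set (is[m := j]) \<subseteq> insert j (set is)" by (rule set_update_subset_insert)
  have "msat V w (clause_fm ?S [] ?as ?cs)"
    using q by (intro thy) (force simp: theory_fms_def hop_clauses_def)
  moreover have "(q, is[m := j]) \<in> all_labels R"
    using q facts sub by (auto simp: all_labels_def rel_labels_def intro: distinct_list_update)
  moreover have "pt i (a' i)" if "i \<in> set ?S" for i
    using that x a K q(3) by (auto simp: clone_def a'_def)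
  moreover have "a' ` set js \<in> V (ix (Rel p js))" if "(p, js) \<in> set ?as" for p js
  proof -
    have "a' ` set is = a ` set is" "a' ` {name_sort, is ! m} = {x, a (is ! m)}" "a' ` {name_sort, j} = {x, a j}"
      using K facts(4) q(3) by (auto simp: a'_def)
    with that R x show ?thesis by (auto simp: clone_def)
  qed
  moreover have "set js \<subseteq> set ?S \<and> js \<noteq> []" if "(p, js) \<in> set ?as" for p js
    using that facts by auto
  ultimately obtain a'' where a'': "\<forall>i\<in>set ?S. a'' i = a' i"
    "a'' ` set (is[m := j]) \<in> V (ix (Rel q (is[m := j])))"
    using clause_sound[of ?S "[]" ?as ?cs a'] q(3) facts sub by (auto simp: less_imp_le subset_iff)
  have "a'' ` set (is[m := j]) = a ` set (is[m := j])"
  proof (rule image_cong[OF refl])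
    fix i assume "i \<in> set (is[m := j])"
    then have "i \<in> set ?S" "i \<noteq> name_sort" using sub K q(3) by auto
    with a''(1) show "a'' i = a i" by (auto simp: a'_def)
  qed
  with a''(2) show ?thesis by simp
qed

text \<open>The intermediate tuple \<open>ks m\<close> has its first \<open>m\<close> arguments
  already moved. Disjointness keeps the next target sort free and lets a single assignment
  \<open>a\<close> carry both the old and the new copies.\<close>

lemma move_disjoint:
  assumes q: "(q, is) \<in> rel_labels R" "(q, js) \<in> rel_labels R" "set is \<inter> set js = {}"
    and len: "length xs = arity q"
    and b: "\<And>m. m < arity q \<Longrightarrow> clone (is ! m) (xs ! m) (b (is ! m))"
    and b': "\<And>m. m < arity q \<Longrightarrow> clone (js ! m) (xs ! m) (b' (js ! m))"
    and R: "b ` set is \<in> V (ix (Rel q is))"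
  shows "b' ` set js \<in> V (ix (Rel q js))"
proof -
  have lens: "length is = arity q" "length js = arity q" "distinct is" "distinct js"
    "set is \<subseteq> {..<name_sort}" "set js \<subseteq> {..<name_sort}" "q \<in> R" "q \<noteq> RName"
    using q by (auto simp: rel_labels_def)
  define a where "a i = (if i \<in> set js then b' i else b i)" for i
  define ks where "ks m = take m js @ drop m is" for m
  have ks_nth: "ks m ! i = (if i < m then js ! i else is ! i)" if "i < arity q" "m \<le> arity q" for i m
    using that lens by (auto simp: ks_def nth_append)
  have len_ks: "length (ks m) = arity q" if "m \<le> arity q" for m using that lens by (simp add: ks_def)
  have a_is: "a (is ! m) = b (is ! m)" and a_js: "a (js ! m) = b' (js ! m)" if "m < arity q" for m
    using that lens q(3) nth_mem[of m "is"] nth_mem[of m js] by (auto simp: a_def disjoint_iff)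
  have ks_clone: "clone (ks m ! i) (xs ! i) (a (ks m ! i))" if "i < arity q" "m \<le> arity q" for i m
    using that by (simp add: ks_nth a_is a_js b b')
  have ks_label: "(q, ks m) \<in> rel_labels R" if "m \<le> arity q" for m
    using that lens q(3) set_take_subset[of m js] set_drop_subset[of m "is"]
    by (auto simp: rel_labels_def ks_def)
  have "a ` set (ks m) \<in> V (ix (Rel q (ks m)))" if "m \<le> arity q" for m
    using that
  proof (induction m)
    case 0
    have "a ` set is = b ` set is" using q(3) by (intro image_cong) (auto simp: a_def)
    with R show ?case by (simp add: ks_def)
  next
    case (Suc m)
    have ks_Suc: "ks (Suc m) = (ks m)[m := js ! m]"
      using Suc.prems lens by (intro nth_equalityI) (auto simp: len_ks ks_nth nth_list_update)
    have "js ! m \<notin> set (ks m)"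
    proof
      assume "js ! m \<in> set (ks m)"
      then obtain i where "i < arity q" "ks m ! i = js ! m"
        using len_ks[of m] Suc.prems by (auto simp: in_set_conv_nth)
      moreover have "js ! m \<in> set js" "m < arity q" using Suc.prems lens by auto
      moreover have "is ! i \<in> set is" using \<open>i < arity q\<close> lens by simp
      ultimately have "i < m \<and> js ! i = js ! m"
        using lens q(3) \<open>i < arity q\<close> \<open>ks m ! i = js ! m\<close> ks_nth[of i m] Suc.prems Suc_leD
        by (metis IntI emptyE order_less_imp_le)
      then show False using lens \<open>i < arity q\<close> \<open>m < arity q\<close> by (auto simp: nth_eq_iff_index_eq)
    qed
    moreover have "js ! m < name_sort" using lens Suc.prems
      by (metis Suc_le_lessD lessThan_iff nth_mem subsetD)
    ultimately show ?case unfolding ks_Suc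
      using Suc lens ks_label[of m] len_ks[of m] ks_clone[of m m] ks_clone
        nth_mem[of m js] b'[of m] a_js[of m]
      by (intro hop[where x = "xs ! m"]) (auto simp: in_set_conv_nth clone_def)
  qed
  from this[of "arity q"] have "a ` set js \<in> V (ix (Rel q js))" using lens by (simp add: ks_def)
  moreover have "a ` set js = b' ` set js" by (intro image_cong) (auto simp: a_def)
  ultimately show ?thesis by simp
qed

text \<open>Overlapping tuples of sorts, such as permutations of each other, may leave no free
  target for a single hop; the detour through \<open>fs\<close> provides one. If both tuples are
  equal, only the copies are exchanged.\<close>

lemma move:
  assumes q: "(q, is) \<in> rel_labels R" "(q, js) \<in> rel_labels R"
    and len: "length xs = arity q"
    and b: "\<And>m. m < arity q \<Longrightarrow> clone (is ! m) (xs ! m) (b (is ! m))"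
    and b': "\<And>m. m < arity q \<Longrightarrow> clone (js ! m) (xs ! m) (b' (js ! m))"
    and R: "b ` set is \<in> V (ix (Rel q is))"
  shows "b' ` set js \<in> V (ix (Rel q js))"
proof -
  have lens: "length is = arity q" "length js = arity q" "set is \<subseteq> {..<name_sort}" "set js \<subseteq> {..<name_sort}"
    "q \<in> R" "q \<noteq> RName"
    using q by (auto simp: rel_labels_def)
  have "card (set is \<union> set js) \<le> 2 * arity q"
    using card_Un_le[of "set is" "set js"] card_length[of "is"] card_length[of js] lens by simp
  then have "arity q \<le> card ({..<name_sort} - (set is \<union> set js))"
    using arity_bounds(2)[of q] lens by (subst card_Diff_subset) auto
  then obtain T where T: "T \<subseteq> {..<name_sort} - (set is \<union> set js)" "card T = arity q" "finite T"
    by (meson finite_Diff finite_lessThan obtain_subset_with_card_n finite_subset)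
  then obtain fs where fs: "set fs = T" "distinct fs"
    using finite_distinct_list by blast
  then have fs': "length fs = arity q" "(q, fs) \<in> rel_labels R" "set is \<inter> set fs = {}" "set fs \<inter> set js = {}"
    using T lens distinct_card[of fs] by (auto simp: rel_labels_def)
  have "\<exists>p. clone (fs ! m) (xs ! m) p" if "m < arity q" for m
    using that b[OF that] T fs fs' nth_mem[of m fs] by (intro clone_exists) (auto simp: clone_def)
  then obtain g where g: "\<And>m. m < arity q \<Longrightarrow> clone (fs ! m) (xs ! m) (g m)" by metis
  \<comment> \<open>Assignments are indexed by sorts, the copies \<open>g\<close> by positions; as
    \<open>fs\<close> is distinct, the position is recovered from the sort.\<close>
  define b'' where "b'' i = g (THE m. m < arity q \<and> fs ! m = i)" for i
  have "b'' (fs ! m) = g m" if "m < arity q" for m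
  proof -
    have "(THE m'. m' < arity q \<and> fs ! m' = fs ! m) = m"
      using that fs fs' by (intro the_equality) (auto simp: nth_eq_iff_index_eq)
    then show ?thesis by (simp add: b''_def)
  qed
  with g have b'': "\<And>m. m < arity q \<Longrightarrow> clone (fs ! m) (xs ! m) (b'' (fs ! m))" by simp
  have R'': "b'' ` set fs \<in> V (ix (Rel q fs))"
    by (rule move_disjoint[OF q(1) fs'(2,3) len b b'' R])
  show ?thesis
    by (rule move_disjoint[OF fs'(2) q(2) fs'(4) len b'' b' R''])
qed

definition names :: "nat set" where "names = {x. pt name_sort x}"

text \<open>One choice of sorts and copies is enough here, because \<open>move\<close> transfers it
  to every other choice.\<close>

definition interp :: "rel_sym \<Rightarrow> nat list set" where
  "interp q = {xs. length xs = arity q \<and> (\<exists>is b. (q, is) \<in> rel_labels R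
     \<and> (\<forall>m<arity q. clone (is ! m) (xs ! m) (b (is ! m))) \<and> b ` set is \<in> V (ix (Rel q is)))}"

lemma finite_names: "finite names"
  by (rule finite_subset[OF _ fin]) (auto simp: names_def pt_def)

text \<open>Copies of the universal elements are chosen in the sorts below \<open>k\<close>,
  \<open>move\<close> brings the antecedents there, and the points that \<open>clause_sound\<close>
  returns are replaced by their names.\<close>

lemma holds_interp:
  assumes c: "c \<in> C"
  shows "holds names interp c"
proof -
  obtain k l as cs where ceq: "c = (k, l, as, cs)" by (cases c)
  have wfc: "0 < k" "k \<le> l" "l \<le> name_sort" "\<And>x. x \<in> set as \<Longrightarrow> wf_atm k x" "\<And>x. x \<in> set cs \<Longrightarrow> wf_atm l x"
    using wf[OF c] by (auto simp: ceq)
  have labels: "(q, is) \<in> rel_labels R" if "(q, is) \<in> set as \<union> set cs" for q "is"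
  proof -
    have "q \<in> R" using syms[OF c] that by (force simp: ceq clause_syms_def)
    moreover have "wf_atm l (q, is)" using that wfc by (force simp: wf_atm_def)
    ultimately show ?thesis using wfc by (force simp: rel_labels_def wf_atm_def)
  qed
  have "\<exists>ys. length ys = l - k \<and> set ys \<subseteq> names \<and> (\<exists>(q, is)\<in>set cs. map ((!) (xs @ ys)) is \<in> interp q)"
    if xs: "length xs = k" "set xs \<subseteq> names" and ants: "\<forall>(q, is)\<in>set as. map ((!) xs) is \<in> interp q" for xs
  proof -
    have "\<exists>p. clone i (xs ! i) p" if "i < k" for i
    proof (rule clone_exists)
      show "i < name_sort" using that wfc by simp
      have "xs ! i \<in> names" using that xs nth_mem by blast
      then show "pt name_sort (xs ! i)" by (simp add: names_def)
    qed
    then obtain a where a: "\<And>i. i < k \<Longrightarrow> clone i (xs ! i) (a i)" by metis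
    have R: "a ` set is \<in> V (ix (Rel q is))" if q: "(q, is) \<in> set as" for q "is"
    proof -
      have "map ((!) xs) is \<in> interp q" using ants q by blast
      then obtain "is'" b where "(q, is') \<in> rel_labels R" "length (map ((!) xs) is) = arity q"
        "\<forall>m<arity q. clone (is' ! m) (map ((!) xs) is ! m) (b (is' ! m))"
        "b ` set is' \<in> V (ix (Rel q is'))"
        unfolding interp_def by blast
      then have *: "(q, is') \<in> rel_labels R" "length is = arity q"
        "\<And>m. m < arity q \<Longrightarrow> clone (is' ! m) (map ((!) xs) is ! m) (b (is' ! m))"
        "b ` set is' \<in> V (ix (Rel q is'))"
        by simp_all
      have clones: "clone (is ! m) (map ((!) xs) is ! m) (a (is ! m))" if "m < arity q" for m
        using that a[of "is ! m"] wfc(4)[OF q] *(2) nth_mem[of m "is"] by (auto simp: wf_atm_def)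
      have "(q, is) \<in> rel_labels R" "length (map ((!) xs) is) = arity q" using labels q * by auto
      then show ?thesis by (rule move[OF *(1) _ _ *(3) clones *(4)])
    qed
    have c1: "msat V w (clause_fm [0..<k] [k..<l] as cs)"
      using c by (intro thy) (force simp: theory_fms_def ceq sort_clause_def)
    have c2: "set is \<subseteq> set [0..<k] \<and> is \<noteq> []" if "(q, is) \<in> set as" for q "is"
      using wfc(4)[OF that] arity_bounds(1)[of q] by (auto simp: wf_atm_def)
    have c3: "(q, is) \<in> all_labels R \<and> set is \<subseteq> set [0..<k] \<union> set [k..<l] \<and> is \<noteq> []"
      if "(q, is) \<in> set cs" for q "is"
      using wfc(2) wfc(5)[OF that] arity_bounds(1)[of q] labels[of q "is"] that
      by (auto simp: wf_atm_def all_labels_def)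
    have c4: "pt i (a i)" if "i \<in> set [0..<k]" for i using that a by (auto simp: clone_def)
    have c5: "[0..<k] \<noteq> []" "set [0..<k] \<subseteq> {..name_sort}" "set [k..<l] \<subseteq> {..name_sort}"
      "set [0..<k] \<inter> set [k..<l] = {}"
      using wfc by auto
    have "\<exists>q is a'. (q, is) \<in> set cs \<and> (\<forall>i\<in>set [0..<k]. a' i = a i) \<and> (\<forall>i\<in>set is. pt i (a' i))
        \<and> a' ` set is \<in> V (ix (Rel q is))"
      by (rule clause_sound[OF c1 c5]; (rule c2 c3 c4 R; assumption)?)
    then obtain q "is" a' where a': "(q, is) \<in> set cs" "\<forall>i<k. a' i = a i" "\<forall>i\<in>set is. pt i (a' i)"
      "a' ` set is \<in> V (ix (Rel q is))"
      by (simp add: Ball_def) blast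
    have is_less: "i < l" if "i \<in> set is" for i using wfc(5)[OF a'(1)] that by (auto simp: wf_atm_def)
    \<comment> \<open>Existential variables absent from the chosen disjunct also need a value; any
      name will do.\<close>
    have "\<exists>x. pt name_sort x \<and> (i \<in> set is \<longrightarrow> clone i x (a' i))" for i
      using name_exists[of i "a' i"] a'(3) is_less[of i] wfc pt_exists[of name_sort] by (fastforce simp: clone_def)
    then obtain h where h: "\<And>i. pt name_sort (h i) \<and> (i \<in> set is \<longrightarrow> clone i (h i) (a' i))" by metis
    define ys where "ys = map h [k..<l]"
    have "clone i ((xs @ ys) ! i) (a' i)" if "i \<in> set is" for i
      using that xs a[of i] a'(2) h[of i] is_less[of i] wfc
      by (cases "i < k") (auto simp: nth_append ys_def)
    moreover have "length is = arity q" using wfc(5)[OF a'(1)] by (auto simp: wf_atm_def)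
    ultimately have "map ((!) (xs @ ys)) is \<in> interp q"
      using a'(4) labels[of q "is"] a'(1) unfolding interp_def
      by (auto intro!: exI[of _ "is"] exI[of _ a'])
    moreover have "length ys = l - k" "set ys \<subseteq> names" using h by (auto simp: ys_def names_def)
    ultimately show ?thesis using a'(1) by blast
  qed
  then show ?thesis by (simp add: ceq)
qed

end

section \<open>Numerals\<close>

text \<open>The atoms \<open>chA k\<close> and \<open>chB k\<close> name copies of the number \<open>k\<close> of two different sorts, so that the
  successor relation between distinct sorts can link consecutive numbers.\<close>

definition chA :: "nat \<Rightarrow> fm" where "chA k = Atom (prod_encode (0, k))"
definition chB :: "nat \<Rightarrow> fm" where "chB k = Atom (prod_encode (1, k))"

text \<open>Unlike a nominal of hybrid logic this claims no uniqueness: \<phi> may hold at several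
  points of sort \<open>i\<close>, and \<open>linked\<close> speaks of all of them.\<close>

definition nominal :: "fm \<Rightarrow> nat \<Rightarrow> fm" where
  "nominal \<phi> i = Conj (Dia \<phi>) (Conj (Box (Imp \<phi> (Box \<phi>))) (Box (Imp \<phi> (lab (Col i)))))"

definition linked :: "fm \<Rightarrow> fm \<Rightarrow> atm \<Rightarrow> fm" where
  "linked \<phi> \<psi> x = Box (Imp (Conj (Dia \<phi>) (Dia \<psi>)) (Dia (lab (Rel (fst x) (snd x)))))"

definition zero_fm :: fm where
  "zero_fm = Conj (nominal (chA 0) 0) (Box (Imp (chA 0) (Dia (lab (Rel RZ [0])))))"

definition step_fm :: "nat \<Rightarrow> fm" where
  "step_fm k = Conj (Conj (nominal (chB k) 1) (nominal (chA (Suc k)) 0))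
     (Conj (linked (chA k) (chB k) (RSame, [0, 1])) (linked (chB k) (chA (Suc k)) (RS, [1, 0])))"

text \<open>One conjunct is added per step, so that the code of the formula is primitive recursive
  in its argument.\<close>

primrec steps_fm :: "nat \<Rightarrow> fm" where
  "steps_fm 0 = Neg Bot"
| "steps_fm (Suc k) = Conj (step_fm k) (steps_fm k)"

text \<open>\<open>zero_fm\<close> does not depend on \<open>x\<close> and is left to the fixed
  formula.\<close>

definition input_fm :: "nat \<Rightarrow> fm" where
  "input_fm x = Conj (Box (Imp (chA x) (Dia (lab (Rel RInp [0]))))) (steps_fm x)"

lemma msat_nominal:
  "msat V w (nominal \<phi> i) \<longleftrightarrow> (\<exists>y\<subseteq>w. y \<noteq> {} \<and> msat V y \<phi>)
    \<and> (\<forall>y\<subseteq>w. y \<noteq> {} \<longrightarrow> msat V y \<phi> \<longrightarrow>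
         y \<in> V (ix (Col i)) \<and> (\<forall>v\<subseteq>y. v \<noteq> {} \<longrightarrow> msat V v \<phi>))"
  unfolding nominal_def by (simp add: imp_conjR all_conj_distrib conj_commute)

lemma msat_linked:
  "msat V w (linked \<phi> \<psi> (q, is)) \<longleftrightarrow> (\<forall>y\<subseteq>w. y \<noteq> {} \<longrightarrow> (\<exists>v\<subseteq>y. v \<noteq> {} \<and> msat V v \<phi>) \<longrightarrow>
    (\<exists>v\<subseteq>y. v \<noteq> {} \<and> msat V v \<psi>) \<longrightarrow> (\<exists>v\<subseteq>y. v \<noteq> {} \<and> v \<in> V (ix (Rel q is))))"
  unfolding linked_def by (simp add: imp_conjL)

lemma msat_steps: "msat V w (steps_fm x) \<longleftrightarrow> (\<forall>k<x. msat V w (step_fm k))"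
  by (induction x) (auto simp: less_Suc_eq)

text \<open>The symbols of the input formulas, which have to be governed by the theory of every
  program.\<close>

definition base_syms :: "rel_sym set" where "base_syms = {RZ, RS, RSame, RInp}"

section \<open>Reading the input off a model\<close>

context theory_model
begin

lemma nominal_point:
  assumes "msat V w (nominal \<phi> i)" "i \<le> name_sort"
  shows "\<exists>p. pt i p \<and> msat V {p} \<phi>"
proof -
  from assms(1) obtain y where y: "y \<subseteq> w" "y \<noteq> {}" "msat V y \<phi>"
    unfolding msat_nominal by (elim conjE exE)
  with assms(1) have y': "\<And>v. v \<subseteq> y \<Longrightarrow> v \<noteq> {} \<Longrightarrow> msat V v \<phi>" "y \<in> V (ix (Col i))"
    unfolding msat_nominal by simp_all
  from y obtain p where "p \<in> y" by blast
  with y y' assms(2) show ?thesis by (intro exI[of _ p]) (auto intro: pt_in)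
qed

text \<open>A labelled set meets every sort of its label, and \<open>b\<close> offers only one point
  for each, so \<open>y\<close> is the whole tuple.\<close>

lemma interpI:
  assumes "(q, is) \<in> rel_labels R" "length xs = arity q" "y \<in> V (ix (Rel q is))" "y \<subseteq> b ` set is"
    and "y \<noteq> {}" "\<And>m. m < arity q \<Longrightarrow> clone (is ! m) (xs ! m) (b (is ! m))"
  shows "xs \<in> interp q"
proof -
  have lens: "length is = arity q" "set is \<subseteq> {..<name_sort}" using assms(1) by (auto simp: rel_labels_def)
  have b: "pt i (b i)" if "i \<in> set is" for i
    using that assms(6) lens by (auto simp: in_set_conv_nth clone_def)
  have yw: "y \<subseteq> w" using b assms(4) by (auto simp: pt_def)
  have "b i \<in> y" if i: "i \<in> set is" for i
  proof -
    from rel_col[of q "is" y i] assms i yw obtain z where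
      z: "z \<subseteq> y" "z \<noteq> {}" "z \<in> V (ix (Col i))" by (auto simp: all_labels_def)
    then obtain p where p: "p \<in> z" by blast
    then obtain j where j: "j \<in> set is" "p = b j" using z assms(4) by blast
    have "i \<le> name_sort" "j \<le> name_sort" using i j lens by auto
    moreover have "pt i p" using z p \<open>i \<le> name_sort\<close> yw pt_in[of i z p] by blast
    ultimately have "i = j" using b j pt_unique by blast
    with z p j show ?thesis by auto
  qed
  then have "b ` set is = y" using assms(4) by auto
  with assms show ?thesis unfolding interp_def by blast
qed

lemma linked_interp:
  assumes sat: "msat V w (linked \<phi> \<psi> (q, [i, j]))" and q: "(q, [i, j]) \<in> rel_labels R" "i \<noteq> j"
    and "pt i p" "msat V {p} \<phi>" "pt j r" "msat V {r} \<psi>"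
    and "clone i x p" "clone j y r"
  shows "[x, y] \<in> interp q"
proof -
  have "{p, r} \<subseteq> w" using assms by (auto simp: pt_def)
  moreover have "\<exists>v\<subseteq>{p, r}. v \<noteq> {} \<and> msat V v \<phi>" "\<exists>v\<subseteq>{p, r}. v \<noteq> {} \<and> msat V v \<psi>"
    using assms by (auto intro: exI[of _ "{p}"] exI[of _ "{r}"])
  ultimately obtain u where u: "u \<subseteq> {p, r}" "u \<noteq> {}" "u \<in> V (ix (Rel q [i, j]))"
    using sat[unfolded msat_linked, rule_format, of "{p, r}"] by blast
  have "arity q = 2" using q by (auto simp: rel_labels_def)
  show ?thesis
    by (rule interpI[OF q(1) _ u(3), where b = "\<lambda>k. if k = i then p else r"])
      (use \<open>arity q = 2\<close> u q(2) assms in \<open>auto simp: less_2_cases_iff\<close>)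
qed

lemma input_interp:
  assumes zero: "msat V w zero_fm" and inp: "msat V w (input_fm x)" and R: "base_syms \<subseteq> R"
  shows "\<exists>c b. [c 0] \<in> interp RZ \<and> [c x] \<in> interp RInp
    \<and> (\<forall>k\<le>x. c k \<in> names) \<and> (\<forall>k<x. b k \<in> names \<and> [c k, b k] \<in> interp RSame \<and> [b k, c (Suc k)] \<in> interp RS)"
proof -
  have labels: "(RZ, [0]) \<in> rel_labels R" "(RInp, [0]) \<in> rel_labels R" "(RSame, [0, 1]) \<in> rel_labels R"
    "(RS, [1, 0]) \<in> rel_labels R"
    using R by (auto simp: rel_labels_def name_sort_def base_syms_def)
  have step: "msat V w (step_fm k)" if "k < x" for k
    using inp that by (simp add: input_fm_def msat_steps)
  have K: "0 < name_sort" "1 < name_sort" by (simp_all add: name_sort_def)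
  have "\<exists>p n. pt 0 p \<and> msat V {p} (chA k) \<and> clone 0 n p" if "k \<le> x" for k
  proof -
    have "msat V w (nominal (chA k) 0)"
      \<comment> \<open>The nominal \<open>chA k\<close> is introduced by the step formula of
        \<open>k - 1\<close>, and \<open>chA 0\<close> by \<open>zero_fm\<close>.\<close>
      using that zero step[of "k - 1"] by (cases k) (auto simp: zero_fm_def step_fm_def)
    then show ?thesis using nominal_point name_exists[OF K(1)] by blast
  qed
  then obtain p c where c: "\<And>k. k \<le> x \<Longrightarrow> pt 0 (p k) \<and> msat V {p k} (chA k) \<and> clone 0 (c k) (p k)"
    by metis
  have "\<exists>r n. pt 1 r \<and> msat V {r} (chB k) \<and> clone 1 n r" if "k < x" for k
  proof -
    have "msat V w (nominal (chB k) 1)" using step[OF that] by (simp add: step_fm_def)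
    moreover have "1 \<le> name_sort" using K by simp
    ultimately show ?thesis using nominal_point name_exists[OF K(2)] by blast
  qed
  then obtain r b where b: "\<And>k. k < x \<Longrightarrow> pt 1 (r k) \<and> msat V {r k} (chB k) \<and> clone 1 (b k) (r k)"
    by metis
  have single: "[c k] \<in> interp q"
    if "k \<le> x" "msat V w (Box (Imp (chA k) (Dia (lab (Rel q [0])))))" "(q, [0]) \<in> rel_labels R" for k q
  proof -
    have "msat V {p k} (Dia (lab (Rel q [0])))" using that c[of k] by (auto simp: pt_def)
    then obtain u where "u \<subseteq> {p k}" "u \<noteq> {}" "u \<in> V (ix (Rel q [0]))" by auto
    moreover have "arity q = 1" using that(3) by (auto simp: rel_labels_def)
    ultimately show ?thesis using c[of k] that
      by (intro interpI[of q "[0]" _ u "\<lambda>_. p k"]) auto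
  qed
  have "[c 0] \<in> interp RZ" using zero labels by (intro single) (auto simp: zero_fm_def)
  moreover have "[c x] \<in> interp RInp" using inp labels by (intro single) (auto simp: input_fm_def)
  moreover have "[c k, b k] \<in> interp RSame" if "k < x" for k
    using step[OF that] labels c[of k] b[of k] that
    by (intro linked_interp[where \<phi> = "chA k" and \<psi> = "chB k" and i = 0 and j = 1 and p = "p k" and r = "r k"])
      (auto simp: step_fm_def)
  moreover have "[b k, c (Suc k)] \<in> interp RS" if "k < x" for k
    using step[OF that] labels c[of "Suc k"] b[of k] that
    by (intro linked_interp[where \<phi> = "chB k" and \<psi> = "chA (Suc k)" and i = 1 and j = 0
          and p = "r k" and r = "p (Suc k)"]) (auto simp: step_fm_def)
  moreover have "\<forall>k\<le>x. c k \<in> names" "\<forall>k<x. b k \<in> names"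
    using c b by (auto simp: names_def clone_def)
  ultimately show ?thesis by blast
qed

end

section \<open>Truth of theory and input in the intended models\<close>

context intended_model
begin

lemma theory_fms_true:
  assumes K: "K = name_sort"
    and wf: "\<And>c. c \<in> C \<Longrightarrow> wf_clause c" and holds: "\<And>c. c \<in> C \<Longrightarrow> holds A I c"
    and name: "I RName = {[x, x] |x. x \<in> A}"
    and \<phi>: "\<phi> \<in> theory_fms R C"
  shows "msat val root \<phi>"
  using \<phi> unfolding theory_fms_def K[symmetric]
proof (elim UnE imageE)
  assume "\<phi> \<in> frame_fms K (all_labels R)"
  then show ?thesis
    by (rule frame_fms_true[rotated]) (auto simp: all_labels_def rel_labels_def K)
next
  fix x assume x: "\<phi> = (case x of (S, E, as, cs) \<Rightarrow> clause_fm S E as cs)" "x \<in> name_clauses"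
  have "sorted_clause_true A I [i] [K] [] [(RName, [K, i])]" "sorted_clause_true A I [K] [i] [] [(RName, [K, i])]" for i
    by (auto simp: sorted_clause_true_def name intro: exI[of _ "\<lambda>_. v i" for v] exI[of _ "\<lambda>_. v K" for v])
  then show ?thesis using x unfolding name_clauses_def K[symmetric]
    by (auto intro!: clause_fm_true)
next
  fix x assume x: "\<phi> = (case x of (S, E, as, cs) \<Rightarrow> clause_fm S E as cs)" "x \<in> hop_clauses R"
  then obtain q "is" m j where *: "(q, is) \<in> rel_labels R" "m < length is" "j < K" "j \<notin> set is"
    "\<phi> = clause_fm (K # j # is) [] [(q, is), (RName, [K, is ! m]), (RName, [K, j])] [(q, is[m := j])]"
    unfolding hop_clauses_def K[symmetric] by auto
  have sub: "set (is[m := j]) \<subseteq> insert j (set is)" by (rule set_update_subset_insert)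
  have "sorted_clause_true A I (K # j # is) [] [(q, is), (RName, [K, is ! m]), (RName, [K, j])] [(q, is[m := j])]"
    unfolding sorted_clause_true_def
  proof (intro allI impI)
    fix v assume "\<forall>(p, js)\<in>set [(q, is), (RName, [K, is ! m]), (RName, [K, j])]. map v js \<in> I p"
    then have v: "map v is \<in> I q" "v K = v (is ! m)" "v K = v j" by (auto simp: name)
    \<comment> \<open>\<open>RName\<close> is the identity, so sort \<open>j\<close> carries the
      same element as the sort that it replaces.\<close>
    have "map v (is[m := j]) = map v is"
      using v *(2) by (simp add: map_update list_update_same_conv)
    with v show "\<exists>v'. (\<forall>i\<in>set (K # j # is). v' i = v i) \<and> (\<forall>i\<in>set []. v' i \<in> A)
        \<and> (\<exists>(q, is)\<in>set [(q, is[m := j])]. map v' is \<in> I q)"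
      by (intro exI[of _ v]) auto
  qed
  moreover have "is ! m \<in> set is" "set is \<subseteq> {..<K}" "is[m := j] \<noteq> []"
    using * by (auto simp: rel_labels_def K)
  ultimately show ?thesis using *(3,4) sub unfolding *(5)
    by (intro clause_fm_true) auto
next
  fix x c assume x: "\<phi> = (case x of (S, E, as, cs) \<Rightarrow> clause_fm S E as cs)" "x = sort_clause c" "c \<in> C"
  obtain k l as cs where c: "c = (k, l, as, cs)" by (cases c)
  have wfc: "k \<le> l" "l \<le> K" "\<And>q is. (q, is) \<in> set as \<Longrightarrow> wf_atm k (q, is)"
    "\<And>q is. (q, is) \<in> set cs \<Longrightarrow> wf_atm l (q, is)"
    using wf[OF x(3)] by (auto simp: c K)
  have "sorted_clause_true A I [0..<k] [k..<l] as cs"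
    unfolding sorted_clause_true_def
  proof (intro allI impI)
    fix v assume v: "\<forall>i\<in>set [0..<k]. v i \<in> A" "\<forall>(q, is)\<in>set as. map v is \<in> I q"
    define xs where "xs = map v [0..<k]"
    have "map ((!) xs) is = map v is" if "(q, is) \<in> set as" for q "is"
      using wfc(3)[OF that] by (auto simp: wf_atm_def xs_def)
    then have "\<forall>(q, is)\<in>set as. map ((!) xs) is \<in> I q" using v(2) by (metis (mono_tags, lifting) case_prodD case_prodI2)
    moreover have "length xs = k" "set xs \<subseteq> A" using v(1) by (auto simp: xs_def)
    ultimately obtain ys x where ys: "length ys = l - k" "set ys \<subseteq> A"
      "x \<in> set cs" "case x of (q, is) \<Rightarrow> map ((!) (xs @ ys)) is \<in> I q"
      using holds[OF x(3)] unfolding c holds.simps by blast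
    have "(xs @ ys) ! i = v i" if "i \<in> set [0..<k]" for i using that by (simp add: xs_def nth_append)
    moreover have "(xs @ ys) ! i \<in> A" if "i \<in> set [k..<l]" for i
      using that ys(1,2) nth_mem[of "i - k" ys] by (auto simp: xs_def nth_append)
    ultimately show "\<exists>v'. (\<forall>i\<in>set [0..<k]. v' i = v i) \<and> (\<forall>i\<in>set [k..<l]. v' i \<in> A)
        \<and> (\<exists>(q, is)\<in>set cs. map v' is \<in> I q)"
      using ys(3,4) by (intro exI[of _ "(!) (xs @ ys)"]) blast
  qed
  moreover have "set is \<subseteq> set [0..<k]" if "(q, is) \<in> set as" for q "is"
    using wfc(3)[OF that] by (auto simp: wf_atm_def)
  moreover have "set is \<subseteq> set [0..<k] \<union> set [k..<l] \<and> is \<noteq> []" if "(q, is) \<in> set cs" for q "is"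
    using wfc(4)[OF that] wfc(1) arity_bounds(1)[of q] by (auto simp: wf_atm_def)
  ultimately have "msat val root (clause_fm [0..<k] [k..<l] as cs)"
    using wfc(1,2) by (intro clause_fm_true) auto
  then show ?thesis by (simp add: x c sort_clause_def)
qed

lemma val_chain [simp]:
  "msat val y (chA k) \<longleftrightarrow> y = {pnt 0 (c k)}" "msat val y (chB k) \<longleftrightarrow> y = {pnt 1 (c k)}"
  by (simp_all add: chA_def chB_def val_def)

lemma pnt_root: "i \<le> K \<Longrightarrow> x \<in> A \<Longrightarrow> pnt i x \<in> root"
  by (auto simp: root_def)

lemma nominal_true:
  assumes "\<And>y. msat val y \<phi> \<longleftrightarrow> y = {pnt i x}" "x \<in> A" "i \<le> K"
  shows "msat val root (nominal \<phi> i)"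
  using assms pnt_root[of i x] by (auto simp: msat_nominal)

lemma linked_true:
  assumes "\<And>y. msat val y \<phi> \<longleftrightarrow> y = {pnt i x}" "\<And>y. msat val y \<psi> \<longleftrightarrow> y = {pnt j z}"
    and "[x, z] \<in> I q" "i \<noteq> j" "x \<in> A" "z \<in> A"
  shows "msat val root (linked \<phi> \<psi> (q, [i, j]))"
proof -
  have "label_val (Rel q [i, j]) {pnt i x, pnt j z}"
    using assms(3-) by (auto intro!: exI[of _ "\<lambda>k. if k = i then x else z"])
  then show ?thesis using assms(1,2) unfolding msat_linked
    by (intro allI impI exI[of _ "{pnt i x, pnt j z}"]) (simp del: label_val.simps)
qed

lemma input_true:
  assumes "\<And>k. k \<le> x \<Longrightarrow> c k \<in> A" "[c 0] \<in> I RZ" "[c x] \<in> I RInp"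
    and "\<And>k. k < x \<Longrightarrow> [c k, c k] \<in> I RSame \<and> [c k, c (Suc k)] \<in> I RS"
  shows "msat val root zero_fm" "msat val root (input_fm x)"
proof -
  have K: "1 \<le> K" "0 \<le> K" using K by auto
  have single: "label_val (Rel q [0]) {pnt 0 a}" if "[a] \<in> I q" "a \<in> A" for a q
    using that by (auto intro!: exI[of _ "\<lambda>_. a"])
  have "msat val root (nominal (chA k) 0)" if "k \<le> x" for k
    using that assms(1) by (intro nominal_true) auto
  moreover have "msat val root (nominal (chB k) 1)" if "k < x" for k
    using that assms(1)[of k] K by (intro nominal_true) auto
  moreover have "msat val root (linked (chA k) (chB k) (RSame, [0, 1]))" if "k < x" for k
    using that assms(1)[of k] assms(4)[OF that]
    by (intro linked_true[where x = "c k" and z = "c k"]) auto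
  moreover have "msat val root (linked (chB k) (chA (Suc k)) (RS, [1, 0]))" if "k < x" for k
    using that assms(1)[of k] assms(1)[of "Suc k"] assms(4)[OF that]
    by (intro linked_true[where x = "c k" and z = "c (Suc k)"]) auto
  moreover have "msat val root (Box (Imp (chA 0) (Dia (lab (Rel RZ [0])))))"
    "msat val root (Box (Imp (chA x) (Dia (lab (Rel RInp [0])))))"
    using single[OF assms(2)] single[OF assms(3)] assms(1) by (auto simp del: label_val.simps)
  ultimately show "msat val root zero_fm" "msat val root (input_fm x)"
    by (simp_all add: zero_fm_def input_fm_def msat_steps step_fm_def)
qed

end

section \<open>Clauses for recursive functions\<close>

text \<open>\<open>RG f\<close> relates an argument list to a value of \<open>f\<close>, \<open>RGL gs\<close> a list to the list of values of \<open>gs\<close>, and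
  \<open>RGM f\<close> holds of \<open>n # t\<close> if \<open>f (m # t)\<close> is positive for all \<open>m < n\<close>. The result of an unbounded search is
  guessed, so it has to be a genuine number: \<open>RW\<close> provides it with a descending chain of predecessors
  along the strict order \<open>RLt\<close>, which ends because the structure is finite.\<close>

definition base_clauses :: "clause list" where
  "base_clauses =
    [(2, 2, [(RZ, [0]), (RS, [1, 0])], []),
     (3, 3, [(RNil, [0]), (RCons, [0, 1, 2])], []),
     (2, 2, [(RSame, [0, 1]), (RZ, [0])], [(RZ, [1])]),
     (3, 3, [(RSame, [0, 1]), (RS, [2, 0])], [(RS, [2, 1])]),
     (1, 2, [(RW, [0])], [(RZ, [0]), (RWS, [1, 0])]),
     (2, 2, [(RWS, [0, 1])], [(RS, [0, 1])]),
     (2, 2, [(RWS, [0, 1])], [(RW, [0])]),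
     (2, 2, [(RWS, [0, 1])], [(RLt, [0, 1])]),
     (3, 3, [(RLt, [0, 1]), (RLt, [1, 2])], [(RLt, [0, 2])]),
     (2, 2, [(RLt, [0, 1]), (RLt, [1, 0])], [])]"

text \<open>The index is consumed by passing to the tail of the argument list; the denials exclude
  lists that are too short.\<close>

primrec proj_clauses :: "nat \<Rightarrow> clause list" where
  "proj_clauses 0 =
    [(2, 2, [(RG (Proj 0), [0, 1]), (RNil, [0])], []),
     (4, 4, [(RG (Proj 0), [0, 1]), (RCons, [0, 2, 3])], [(RSame, [2, 1])])]"
| "proj_clauses (Suc i) =
    [(2, 2, [(RG (Proj (Suc i)), [0, 1]), (RNil, [0])], []),
     (4, 4, [(RG (Proj (Suc i)), [0, 1]), (RCons, [0, 2, 3])], [(RG (Proj i), [3, 1])])]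
    @ proj_clauses i"

primrec list_clauses :: "recf list \<Rightarrow> clause list" where
  "list_clauses [] = [(2, 2, [(RGL [], [0, 1])], [(RNil, [1])])]"
| "list_clauses (g # gs) =
    [(2, 4, [(RGL (g # gs), [0, 1])], [(RGC g gs, [0, 1, 2, 3])]),
     (4, 4, [(RGC g gs, [0, 1, 2, 3])], [(RCons, [1, 2, 3])]),
     (4, 4, [(RGC g gs, [0, 1, 2, 3])], [(RG g, [0, 2])]),
     (4, 4, [(RGC g gs, [0, 1, 2, 3])], [(RGL gs, [0, 3])])]
    @ list_clauses gs"

text \<open>The clauses run from a recorded value down to the values it rests on, never upward. The
  entries of \<open>RPR f g\<close> are the value, the parameters \<open>t\<close>, the predecessor
  \<open>p\<close>, the recursive value \<open>r\<close> and the lists \<open>p # t\<close>,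
  \<open>r # t\<close>, \<open>p # r # t\<close>; these seven make it the widest relation. The last
  entry of \<open>RGMA f\<close> is a predecessor of the value of \<open>f\<close>, which certifies
  that this value is positive.\<close>

fun recf_clauses :: "recf \<Rightarrow> clause list" where
  "recf_clauses Zero = [(2, 2, [(RG Zero, [0, 1])], [(RZ, [1])])]"
| "recf_clauses Succ =
    [(2, 2, [(RG Succ, [0, 1]), (RNil, [0])], []),
     (4, 4, [(RG Succ, [0, 1]), (RCons, [0, 2, 3])], [(RNil, [3])]),
     (4, 4, [(RG Succ, [0, 1]), (RCons, [0, 2, 3])], [(RS, [2, 1])])]"
| "recf_clauses (Proj i) = proj_clauses i"
| "recf_clauses (Comp f gs) =
    [(2, 3, [(RG (Comp f gs), [0, 1])], [(RCm f gs, [0, 1, 2])]),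
     (3, 3, [(RCm f gs, [0, 1, 2])], [(RGL gs, [0, 2])]),
     (3, 3, [(RCm f gs, [0, 1, 2])], [(RG f, [2, 1])])]
    @ list_clauses gs @ recf_clauses f @ concat (map recf_clauses gs)"
| "recf_clauses (PrimRec f g) =
    [(2, 2, [(RG (PrimRec f g), [0, 1]), (RNil, [0])], []),
     (4, 4, [(RG (PrimRec f g), [0, 1]), (RCons, [0, 2, 3]), (RZ, [2])], [(RG f, [3, 1])]),
     (5, 9, [(RG (PrimRec f g), [0, 1]), (RCons, [0, 2, 3]), (RS, [4, 2])],
        [(RPR f g, [1, 3, 4, 5, 6, 7, 8])]),
     (7, 7, [(RPR f g, [0, 1, 2, 3, 4, 5, 6])], [(RCons, [4, 2, 1])]),
     (7, 7, [(RPR f g, [0, 1, 2, 3, 4, 5, 6])], [(RG (PrimRec f g), [4, 3])]),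
     (7, 7, [(RPR f g, [0, 1, 2, 3, 4, 5, 6])], [(RCons, [5, 3, 1])]),
     (7, 7, [(RPR f g, [0, 1, 2, 3, 4, 5, 6])], [(RCons, [6, 2, 5])]),
     (7, 7, [(RPR f g, [0, 1, 2, 3, 4, 5, 6])], [(RG g, [6, 0])])]
    @ recf_clauses f @ recf_clauses g"
| "recf_clauses (Mu f) =
    [(2, 4, [(RG (Mu f), [0, 1])], [(RMuA f, [0, 1, 2, 3])]),
     (4, 4, [(RMuA f, [0, 1, 2, 3])], [(RW, [1])]),
     (4, 4, [(RMuA f, [0, 1, 2, 3])], [(RCons, [2, 1, 0])]),
     (4, 4, [(RMuA f, [0, 1, 2, 3])], [(RG f, [2, 3])]),
     (4, 4, [(RMuA f, [0, 1, 2, 3])], [(RZ, [3])]),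
     (4, 4, [(RMuA f, [0, 1, 2, 3])], [(RGM f, [2])]),
     (4, 7, [(RGM f, [0]), (RCons, [0, 1, 2]), (RS, [3, 1])], [(RGMA f, [2, 3, 4, 5, 6])]),
     (5, 5, [(RGMA f, [0, 1, 2, 3, 4])], [(RCons, [2, 1, 0])]),
     (5, 5, [(RGMA f, [0, 1, 2, 3, 4])], [(RG f, [2, 3])]),
     (5, 5, [(RGMA f, [0, 1, 2, 3, 4])], [(RS, [4, 3])]),
     (5, 5, [(RGMA f, [0, 1, 2, 3, 4])], [(RGM f, [2])])]
    @ recf_clauses f"

text \<open>This sets the unfolding going: the input is made a one-element list, for which some
  value must be recorded.\<close>

definition start_clauses :: "recf \<Rightarrow> clause list" where
  "start_clauses f =
    [(1, 4, [(RInp, [0])], [(RSt, [0, 1, 2, 3])]),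
     (4, 4, [(RSt, [0, 1, 2, 3])], [(RCons, [1, 0, 2])]),
     (4, 4, [(RSt, [0, 1, 2, 3])], [(RNil, [2])]),
     (4, 4, [(RSt, [0, 1, 2, 3])], [(RG f, [1, 3])])]"

lemma wf_recf_clauses:
  "\<forall>c\<in>set base_clauses. wf_clause c"
  "\<forall>c\<in>set (recf_clauses f). wf_clause c"
  "\<forall>c\<in>set (start_clauses f). wf_clause c"
proof -
  have proj: "\<forall>c\<in>set (proj_clauses i). wf_clause c" for i
    by (induction i) (simp_all add: wf_atm_def name_sort_def)
  have list: "\<forall>c\<in>set (list_clauses gs). wf_clause c" for gs
    by (induction gs) (simp_all add: wf_atm_def name_sort_def)
  show "\<forall>c\<in>set (recf_clauses f). wf_clause c"
  proof (induction f rule: recf_clauses.induct)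
    case (4 f gs)
    then show ?case using list[of gs] by (auto simp: wf_atm_def name_sort_def)
  qed (use proj in \<open>simp_all add: wf_atm_def name_sort_def ball_Un\<close>)
qed (simp_all add: base_clauses_def start_clauses_def wf_atm_def name_sort_def)

section \<open>Soundness: recorded values are correct\<close>

locale fo_model =
  fixes A :: "'a set" and I :: "rel_sym \<Rightarrow> 'a list set"
  assumes finA: "finite A" and base: "\<And>c. c \<in> set base_clauses \<Longrightarrow> holds A I c"
begin

text \<open>An element may represent several numbers or lists, since successors and decompositions are not
  required to be unique. Soundness survives because inputs are decomposed in all possible ways.\<close>

inductive num :: "'a \<Rightarrow> nat \<Rightarrow> bool" where
  "x \<in> A \<Longrightarrow> [x] \<in> I RZ \<Longrightarrow> num x 0"
| "num y n \<Longrightarrow> x \<in> A \<Longrightarrow> [y, x] \<in> I RS \<Longrightarrow> num x (Suc n)"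

inductive lst :: "'a \<Rightarrow> nat list \<Rightarrow> bool" where
  "d \<in> A \<Longrightarrow> [d] \<in> I RNil \<Longrightarrow> lst d []"
| "d \<in> A \<Longrightarrow> num h n \<Longrightarrow> lst t ns \<Longrightarrow> [d, h, t] \<in> I RCons \<Longrightarrow> lst d (n # ns)"

lemma num_in: "num x n \<Longrightarrow> x \<in> A" by (auto elim: num.cases)
lemma lst_in: "lst x ns \<Longrightarrow> x \<in> A" by (auto elim: lst.cases)

lemma ax:
  "z \<in> A \<Longrightarrow> a \<in> A \<Longrightarrow> [z] \<in> I RZ \<Longrightarrow> [a, z] \<notin> I RS"
  "d \<in> A \<Longrightarrow> h \<in> A \<Longrightarrow> t \<in> A \<Longrightarrow> [d] \<in> I RNil \<Longrightarrow> [d, h, t] \<notin> I RCons"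
  "x \<in> A \<Longrightarrow> y \<in> A \<Longrightarrow> [x, y] \<in> I RSame \<Longrightarrow> [x] \<in> I RZ \<Longrightarrow> [y] \<in> I RZ"
  "x \<in> A \<Longrightarrow> y \<in> A \<Longrightarrow> z \<in> A \<Longrightarrow> [x, y] \<in> I RSame \<Longrightarrow> [z, x] \<in> I RS \<Longrightarrow> [z, y] \<in> I RS"
  "x \<in> A \<Longrightarrow> y \<in> A \<Longrightarrow> [x, y] \<in> I RWS \<Longrightarrow> [x, y] \<in> I RS \<and> [x] \<in> I RW \<and> [x, y] \<in> I RLt"
  "x \<in> A \<Longrightarrow> y \<in> A \<Longrightarrow> z \<in> A \<Longrightarrow> [x, y] \<in> I RLt \<Longrightarrow> [y, z] \<in> I RLt \<Longrightarrow> [x, z] \<in> I RLt"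
  "x \<in> A \<Longrightarrow> y \<in> A \<Longrightarrow> [x, y] \<in> I RLt \<Longrightarrow> [y, x] \<notin> I RLt"
proof -
  have h: "holds A I (base_clauses ! i)" if "i < length base_clauses" for i
    using that by (simp add: base)
  note h' = h[unfolded base_clauses_def]
  show "z \<in> A \<Longrightarrow> a \<in> A \<Longrightarrow> [z] \<in> I RZ \<Longrightarrow> [a, z] \<notin> I RS" for z a
    using h'[of 0] by (auto dest: spec[of _ "[z, a]"])
  show "d \<in> A \<Longrightarrow> h \<in> A \<Longrightarrow> t \<in> A \<Longrightarrow> [d] \<in> I RNil \<Longrightarrow> [d, h, t] \<notin> I RCons" for d h t
    using h'[of 1] by (auto dest: spec[of _ "[d, h, t]"])
  show "x \<in> A \<Longrightarrow> y \<in> A \<Longrightarrow> [x, y] \<in> I RSame \<Longrightarrow> [x] \<in> I RZ \<Longrightarrow> [y] \<in> I RZ" for x y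
    using h'[of 2] by (auto dest: spec[of _ "[x, y]"])
  show "x \<in> A \<Longrightarrow> y \<in> A \<Longrightarrow> z \<in> A \<Longrightarrow> [x, y] \<in> I RSame \<Longrightarrow> [z, x] \<in> I RS \<Longrightarrow> [z, y] \<in> I RS" for x y z
    using h'[of 3] by (auto dest: spec[of _ "[x, y, z]"])
  show "x \<in> A \<Longrightarrow> y \<in> A \<Longrightarrow> [x, y] \<in> I RWS \<Longrightarrow> [x, y] \<in> I RS \<and> [x] \<in> I RW \<and> [x, y] \<in> I RLt" for x y
    using h'[of 5] h'[of 6] h'[of 7] by (auto dest: spec[of _ "[x, y]"])
  show "x \<in> A \<Longrightarrow> y \<in> A \<Longrightarrow> z \<in> A \<Longrightarrow> [x, y] \<in> I RLt \<Longrightarrow> [y, z] \<in> I RLt \<Longrightarrow> [x, z] \<in> I RLt" for x y z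
    using h'[of 8] by (auto dest: spec[of _ "[x, y, z]"])
  show "x \<in> A \<Longrightarrow> y \<in> A \<Longrightarrow> [x, y] \<in> I RLt \<Longrightarrow> [y, x] \<notin> I RLt" for x y
    using h'[of 9] by (auto dest: spec[of _ "[x, y]"])
qed

lemma guess_pred:
  assumes "x \<in> A" "[x] \<in> I RW" "[x] \<notin> I RZ"
  shows "\<exists>y\<in>A. [y, x] \<in> I RWS"
proof -
  have "holds A I (base_clauses ! 4)" by (rule base) (simp add: base_clauses_def)
  then show ?thesis using assms
    by (auto simp: base_clauses_def length_Suc_conv dest!: spec[of _ "[x]"])
qed

end

lemma holdsD:
  assumes "holds A I (k, l, as, cs)" "length xs = k" "set xs \<subseteq> A"
    and "\<forall>(q, is)\<in>set as. map ((!) xs) is \<in> I q"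
  shows "\<exists>ys. length ys = l - k \<and> set ys \<subseteq> A \<and> (\<exists>(q, is)\<in>set cs. map ((!) (xs @ ys)) is \<in> I q)"
  using assms by simp

context fo_model
begin

lemma guess_num:
  assumes "x \<in> A" "[x] \<in> I RW"
  shows "\<exists>n. num x n"
proof -
  define r where "r = {(y, x). y \<in> A \<and> x \<in> A \<and> [y, x] \<in> I RLt}"
  have "finite r" by (rule finite_subset[of _ "A \<times> A"]) (auto simp: r_def finA)
  moreover have "trans r"
  proof (rule transI)
    fix x y z assume "(x, y) \<in> r" "(y, z) \<in> r"
    then show "(x, z) \<in> r" using ax(6)[of x y z] by (simp add: r_def)
  qed
  \<comment> \<open>\<open>ax(7)\<close> at equal arguments gives irreflexivity, and the transitive
    \<open>r\<close> is its own closure.\<close>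
  then have "acyclic r" using ax(7) by (auto simp: acyclic_def trancl_id r_def)
  ultimately have "wf r" by (rule finite_acyclic_wf)
  then show ?thesis using assms
  proof (induction x rule: wf_induct_rule)
    case (less x)
    show ?case
    proof (cases "[x] \<in> I RZ")
      case True
      then show ?thesis using less.prems num.intros(1) by blast
    next
      case False
      then obtain y where y: "y \<in> A" "[y, x] \<in> I RWS" using guess_pred less.prems by blast
      then have "(y, x) \<in> r" "[y, x] \<in> I RS" "[y] \<in> I RW" using ax(5) less.prems by (auto simp: r_def)
      with y less show ?thesis using num.intros(2) by blast
    qed
  qed
qed

text \<open>A case distinction suffices: \<open>RSame\<close> transfers the property of being zero
  and the immediate predecessors, and nothing below a predecessor has to be copied.\<close>

lemma num_same: "num x n \<Longrightarrow> y \<in> A \<Longrightarrow> [x, y] \<in> I RSame \<Longrightarrow> num y n"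
proof (induction rule: num.cases)
  case (1 x)
  then show ?case using ax(3) num.intros(1) by blast
next
  case (2 z m x)
  then show ?case using ax(4) num_in num.intros(2) by blast
qed

text \<open>No zero has a predecessor, so an element that represents several numbers represents
  positive ones only.\<close>

lemma num_zero_iff:
  assumes "num x n"
  shows "[x] \<in> I RZ \<longleftrightarrow> n = 0"
  using assms by (cases rule: num.cases) (use ax(1) num_in in auto)

lemma num_pred:
  assumes "num x (Suc n)"
  obtains y where "num y n" "[y, x] \<in> I RS"
  using assms by (cases rule: num.cases) auto

lemma lst_Nil: "lst d [] \<Longrightarrow> [d] \<in> I RNil"
  by (auto elim: lst.cases)

lemma lst_Cons:
  assumes "lst d (n # ns)"
  obtains h t where "num h n" "lst t ns" "[d, h, t] \<in> I RCons"
  using assms by (cases rule: lst.cases) auto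

lemma lst_nil_iff: "lst d ns \<Longrightarrow> [d] \<in> I RNil \<longleftrightarrow> ns = []"
  by (cases rule: lst.cases) (use ax(2) num_in lst_in in auto)

text \<open>Representations are not unique, so the claim covers every list that \<open>d\<close>
  represents and asks for the correct value only among the numbers that \<open>y\<close>
  represents.\<close>

definition computes :: "recf \<Rightarrow> bool" where
  "computes f \<longleftrightarrow> (\<forall>d ns y. lst d ns \<longrightarrow> y \<in> A \<longrightarrow> [d, y] \<in> I (RG f) \<longrightarrow>
     (\<exists>m. num y m \<and> rec_eval f ns m))"

definition computes_list :: "recf list \<Rightarrow> bool" where
  "computes_list gs \<longleftrightarrow> (\<forall>d ns e. lst d ns \<longrightarrow> e \<in> A \<longrightarrow> [d, e] \<in> I (RGL gs) \<longrightarrow>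
     (\<exists>ms. lst e ms \<and> list_all2 (\<lambda>g m. rec_eval g ns m) gs ms))"

lemma computes_zero:
  assumes "\<forall>c\<in>set (recf_clauses Zero). holds A I c"
  shows "computes Zero"
proof -
  have "holds A I (2, 2, [(RG Zero, [0, 1])], [(RZ, [1])])" using assms by simp
  note c = holdsD[OF this]
  show ?thesis unfolding computes_def
  proof (intro allI impI)
    fix d ns y assume "lst d ns" "y \<in> A" "[d, y] \<in> I (RG Zero)"
    then have "[y] \<in> I RZ" using c[of "[d, y]"] lst_in by auto
    with \<open>y \<in> A\<close> show "\<exists>m. num y m \<and> rec_eval Zero ns m"
      by (intro exI[of _ 0]) (auto intro: num.intros rec_eval.intros)
  qed
qed

lemma computes_succ:
  assumes "\<forall>c\<in>set (recf_clauses Succ). holds A I c"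
  shows "computes Succ"
proof -
  have "holds A I (2, 2, [(RG Succ, [0, 1]), (RNil, [0])], [])"
    "holds A I (4, 4, [(RG Succ, [0, 1]), (RCons, [0, 2, 3])], [(RNil, [3])])"
    "holds A I (4, 4, [(RG Succ, [0, 1]), (RCons, [0, 2, 3])], [(RS, [2, 1])])" using assms by simp_all
  note c = this[THEN holdsD]
  show ?thesis unfolding computes_def
  proof (intro allI impI)
    fix d ns y assume d: "lst d ns" "y \<in> A" "[d, y] \<in> I (RG Succ)"
    show "\<exists>m. num y m \<and> rec_eval Succ ns m"
    proof (cases ns)
      case Nil
      then show ?thesis using c(1)[of "[d, y]"] d lst_in lst_Nil by auto
    next
      case (Cons n ns')
      with d(1) obtain h t where ht: "num h n" "lst t ns'" "[d, h, t] \<in> I RCons" using lst_Cons by blast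
      then have "[t] \<in> I RNil" "[h, y] \<in> I RS"
        using c(2,3)[of "[d, y, h, t]"] d lst_in num_in by auto
      with ht d have "ns' = []" "num y (Suc n)" using lst_nil_iff num.intros(2) by auto
      with Cons show ?thesis by (auto intro: rec_eval.intros)
    qed
  qed
qed

lemma computes_proj:
  assumes "\<forall>c\<in>set (proj_clauses i). holds A I c"
  shows "computes (Proj i)"
  using assms
proof (induction i)
  case 0
  then have "holds A I (2, 2, [(RG (Proj 0), [0, 1]), (RNil, [0])], [])"
     "holds A I (4, 4, [(RG (Proj 0), [0, 1]), (RCons, [0, 2, 3])], [(RSame, [2, 1])])" by simp_all
  note c = this[THEN holdsD]
  show ?case unfolding computes_def
  proof (intro allI impI)
    fix d ns y assume d: "lst d ns" "y \<in> A" "[d, y] \<in> I (RG (Proj 0))"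
    show "\<exists>m. num y m \<and> rec_eval (Proj 0) ns m"
    proof (cases ns)
      case Nil
      then show ?thesis using c(1)[of "[d, y]"] d lst_in lst_Nil by auto
    next
      case (Cons n ns')
      with d(1) obtain h t where ht: "num h n" "lst t ns'" "[d, h, t] \<in> I RCons" using lst_Cons by blast
      then have "[h, y] \<in> I RSame"
        using c(2)[of "[d, y, h, t]"] d lst_in num_in by auto
      with ht d have "num y n" using num_same by blast
      moreover have "rec_eval (Proj 0) (n # ns') ((n # ns') ! 0)" by (rule rec_eval.Proj) simp
      ultimately show ?thesis using Cons by auto
    qed
  qed
next
  case (Suc i)
  then have "holds A I (2, 2, [(RG (Proj (Suc i)), [0, 1]), (RNil, [0])], [])"
    "holds A I (4, 4, [(RG (Proj (Suc i)), [0, 1]), (RCons, [0, 2, 3])], [(RG (Proj i), [3, 1])])" by simp_all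
  note c = this[THEN holdsD]
  have IH: "computes (Proj i)" using Suc by simp
  show ?case unfolding computes_def
  proof (intro allI impI)
    fix d ns y assume d: "lst d ns" "y \<in> A" "[d, y] \<in> I (RG (Proj (Suc i)))"
    show "\<exists>m. num y m \<and> rec_eval (Proj (Suc i)) ns m"
    proof (cases ns)
      case Nil
      then show ?thesis using c(1)[of "[d, y]"] d lst_in lst_Nil by auto
    next
      case (Cons n ns')
      with d(1) obtain h t where ht: "num h n" "lst t ns'" "[d, h, t] \<in> I RCons" using lst_Cons by blast
      then have "[t, y] \<in> I (RG (Proj i))"
        using c(2)[of "[d, y, h, t]"] d lst_in num_in by auto
      with ht d IH obtain m where m: "num y m" "rec_eval (Proj i) ns' m"
        unfolding computes_def by blast
      from m(2) have "i < length ns'" "m = ns' ! i" by (auto elim: rec_eval.cases)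
      then have "rec_eval (Proj (Suc i)) ns m" using Cons rec_eval.Proj[of "Suc i" ns] by simp
      with m show ?thesis by blast
    qed
  qed
qed

lemma computes_gs:
  assumes "\<forall>c\<in>set (list_clauses gs). holds A I c" "\<forall>g\<in>set gs. computes g"
  shows "computes_list gs"
  using assms
proof (induction gs)
  case Nil
  then have "holds A I (2, 2, [(RGL [], [0, 1])], [(RNil, [1])])" by simp
  note c = holdsD[OF this]
  show ?case unfolding computes_list_def
  proof (intro allI impI)
    fix d ns e assume "lst d ns" "e \<in> A" "[d, e] \<in> I (RGL [])"
    then have "[e] \<in> I RNil" using c[of "[d, e]"] lst_in by auto
    with \<open>e \<in> A\<close> show "\<exists>ms. lst e ms \<and> list_all2 (\<lambda>g m. rec_eval g ns m) [] ms"
      by (intro exI[of _ "[]"]) (auto intro: lst.intros)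
  qed
next
  case (Cons g gs)
  then have "holds A I (2, 4, [(RGL (g # gs), [0, 1])], [(RGC g gs, [0, 1, 2, 3])])"
     "holds A I (4, 4, [(RGC g gs, [0, 1, 2, 3])], [(RCons, [1, 2, 3])])"
     "holds A I (4, 4, [(RGC g gs, [0, 1, 2, 3])], [(RG g, [0, 2])])"
     "holds A I (4, 4, [(RGC g gs, [0, 1, 2, 3])], [(RGL gs, [0, 3])])" by simp_all
  note c = this[THEN holdsD]
  have IH: "computes_list gs" "computes g" using Cons by auto
  show ?case unfolding computes_list_def
  proof (intro allI impI)
    fix d ns e assume d: "lst d ns" "e \<in> A" "[d, e] \<in> I (RGL (g # gs))"
    then obtain h t where ht: "h \<in> A" "t \<in> A" "[d, e, h, t] \<in> I (RGC g gs)"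
      using c(1)[of "[d, e]"] lst_in by (auto simp: length_Suc_conv numeral_2_eq_2)
    then have *: "[e, h, t] \<in> I RCons" "[d, h] \<in> I (RG g)" "[d, t] \<in> I (RGL gs)"
      using c(2-4)[of "[d, e, h, t]"] d lst_in by auto
    with d ht IH obtain m ms where "num h m" "rec_eval g ns m" "lst t ms"
      "list_all2 (\<lambda>g m. rec_eval g ns m) gs ms"
      unfolding computes_def computes_list_def by metis
    with * d show "\<exists>ms. lst e ms \<and> list_all2 (\<lambda>g m. rec_eval g ns m) (g # gs) ms"
      by (intro exI[of _ "m # ms"]) (auto intro: lst.intros)
  qed
qed

lemma computes_comp:
  assumes "\<forall>c\<in>set (recf_clauses (Comp f gs)). holds A I c" "computes f" "\<forall>g\<in>set gs. computes g"
  shows "computes (Comp f gs)"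
proof -
  have "holds A I (2, 3, [(RG (Comp f gs), [0, 1])], [(RCm f gs, [0, 1, 2])])"
     "holds A I (3, 3, [(RCm f gs, [0, 1, 2])], [(RGL gs, [0, 2])])"
     "holds A I (3, 3, [(RCm f gs, [0, 1, 2])], [(RG f, [2, 1])])" using assms(1) by simp_all
  note c = this[THEN holdsD]
  have gs: "computes_list gs" using assms by (intro computes_gs) auto
  show ?thesis unfolding computes_def
  proof (intro allI impI)
    fix d ns y assume d: "lst d ns" "y \<in> A" "[d, y] \<in> I (RG (Comp f gs))"
    then obtain e where e: "e \<in> A" "[d, y, e] \<in> I (RCm f gs)"
      using c(1)[of "[d, y]"] lst_in by (auto simp: length_Suc_conv)
    then have "[d, e] \<in> I (RGL gs)" "[e, y] \<in> I (RG f)"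
      using c(2,3)[of "[d, y, e]"] d lst_in by auto
    with d e gs assms(2) obtain ms m where "list_all2 (\<lambda>g m. rec_eval g ns m) gs ms"
      "num y m" "rec_eval f ms m" unfolding computes_def computes_list_def by metis
    then show "\<exists>m. num y m \<and> rec_eval (Comp f gs) ns m" using rec_eval.Comp by blast
  qed
qed

lemma computes_prim_rec:
  assumes "\<forall>c\<in>set (recf_clauses (PrimRec f g)). holds A I c" "computes f" "computes g"
  shows "computes (PrimRec f g)"
proof -
  have "holds A I (2, 2, [(RG (PrimRec f g), [0, 1]), (RNil, [0])], [])"
     "holds A I (4, 4, [(RG (PrimRec f g), [0, 1]), (RCons, [0, 2, 3]), (RZ, [2])], [(RG f, [3, 1])])"
     "holds A I (5, 9, [(RG (PrimRec f g), [0, 1]), (RCons, [0, 2, 3]), (RS, [4, 2])],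
        [(RPR f g, [1, 3, 4, 5, 6, 7, 8])])"
     "holds A I (7, 7, [(RPR f g, [0, 1, 2, 3, 4, 5, 6])], [(RCons, [4, 2, 1])])"
     "holds A I (7, 7, [(RPR f g, [0, 1, 2, 3, 4, 5, 6])], [(RG (PrimRec f g), [4, 3])])"
     "holds A I (7, 7, [(RPR f g, [0, 1, 2, 3, 4, 5, 6])], [(RCons, [5, 3, 1])])"
     "holds A I (7, 7, [(RPR f g, [0, 1, 2, 3, 4, 5, 6])], [(RCons, [6, 2, 5])])"
     "holds A I (7, 7, [(RPR f g, [0, 1, 2, 3, 4, 5, 6])], [(RG g, [6, 0])])"
    using assms(1) by simp_all
  note c = this[THEN holdsD]
  have rec: "\<exists>m. num y m \<and> rec_eval (PrimRec f g) (n # ns) m"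
    if "lst d (n # ns)" "y \<in> A" "[d, y] \<in> I (RG (PrimRec f g))" for d y n ns
    using that
  \<comment> \<open>The recursive call is recorded at another list element, \<open>e1\<close>, and
    with another value, \<open>r\<close>.\<close>
  proof (induction n arbitrary: d y)
    case 0
    then obtain h t where ht: "num h 0" "lst t ns" "[d, h, t] \<in> I RCons" using lst_Cons by blast
    then have "[t, y] \<in> I (RG f)"
      using c(2)[of "[d, y, h, t]"] 0 lst_in num_in num_zero_iff by auto
    with ht 0 assms(2) show ?case unfolding computes_def using rec_eval.PrimRec_0 by blast
  next
    case (Suc n)
    then obtain h t where ht: "num h (Suc n)" "lst t ns" "[d, h, t] \<in> I RCons" using lst_Cons by blast
    then obtain p where p: "num p n" "[p, h] \<in> I RS" using num_pred by blast
    have "\<exists>r e1 u e2. r \<in> A \<and> e1 \<in> A \<and> u \<in> A \<and> e2 \<in> A \<and> [y, t, p, r, e1, u, e2] \<in> I (RPR f g)"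
      using c(3)[of "[d, y, h, t, p]"] Suc.prems ht p lst_in num_in
      by (auto simp: length_Suc_conv numeral_eq_Suc) blast
    then obtain r e1 u e2 where w: "r \<in> A" "e1 \<in> A" "u \<in> A" "e2 \<in> A" "[y, t, p, r, e1, u, e2] \<in> I (RPR f g)"
      by blast
    have in_A: "y \<in> A" "t \<in> A" "p \<in> A" using Suc.prems ht p lst_in num_in by auto
    have *: "[e1, p, t] \<in> I RCons" "[e1, r] \<in> I (RG (PrimRec f g))" "[u, r, t] \<in> I RCons"
      "[e2, p, u] \<in> I RCons" "[e2, y] \<in> I (RG g)"
      using c(4-8)[of "[y, t, p, r, e1, u, e2]"] w in_A by auto
    have "lst e1 (n # ns)" by (rule lst.intros(2)[OF w(2) p(1) ht(2) *(1)])
    with Suc.IH w * obtain m where m: "num r m" "rec_eval (PrimRec f g) (n # ns) m" by blast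
    have "lst u (m # ns)" by (rule lst.intros(2)[OF w(3) m(1) ht(2) *(3)])
    then have "lst e2 (n # m # ns)" by (rule lst.intros(2)[OF w(4) p(1) _ *(4)])
    with assms(3) * in_A obtain m' where "num y m'" "rec_eval g (n # m # ns) m'"
      unfolding computes_def by blast
    with m show ?case using rec_eval.PrimRec_Suc by blast
  qed
  show ?thesis unfolding computes_def
  proof (intro allI impI)
    fix d ns y assume d: "lst d ns" "y \<in> A" "[d, y] \<in> I (RG (PrimRec f g))"
    show "\<exists>m. num y m \<and> rec_eval (PrimRec f g) ns m"
    proof (cases ns)
      case Nil
      then show ?thesis using c(1)[of "[d, y]"] d lst_in lst_Nil by auto
    next
      case (Cons n ns')
      then show ?thesis using rec d by blast
    qed
  qed
qed

lemma computes_mu: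
  assumes "\<forall>c\<in>set (recf_clauses (Mu f)). holds A I c" "computes f"
  shows "computes (Mu f)"
proof -
  have "holds A I (2, 4, [(RG (Mu f), [0, 1])], [(RMuA f, [0, 1, 2, 3])])"
     "holds A I (4, 4, [(RMuA f, [0, 1, 2, 3])], [(RW, [1])])"
     "holds A I (4, 4, [(RMuA f, [0, 1, 2, 3])], [(RCons, [2, 1, 0])])"
     "holds A I (4, 4, [(RMuA f, [0, 1, 2, 3])], [(RG f, [2, 3])])"
     "holds A I (4, 4, [(RMuA f, [0, 1, 2, 3])], [(RZ, [3])])"
     "holds A I (4, 4, [(RMuA f, [0, 1, 2, 3])], [(RGM f, [2])])"
     "holds A I (4, 7, [(RGM f, [0]), (RCons, [0, 1, 2]), (RS, [3, 1])], [(RGMA f, [2, 3, 4, 5, 6])])"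
     "holds A I (5, 5, [(RGMA f, [0, 1, 2, 3, 4])], [(RCons, [2, 1, 0])])"
     "holds A I (5, 5, [(RGMA f, [0, 1, 2, 3, 4])], [(RG f, [2, 3])])"
     "holds A I (5, 5, [(RGMA f, [0, 1, 2, 3, 4])], [(RS, [4, 3])])"
     "holds A I (5, 5, [(RGMA f, [0, 1, 2, 3, 4])], [(RGM f, [2])])"
    using assms(1) by simp_all
  note c = this[THEN holdsD]
  have below: "\<forall>j<n. \<exists>k. rec_eval f (j # ns) (Suc k)"
    if "lst d (n # ns)" "[d] \<in> I (RGM f)" for d n ns
    using that
  proof (induction n arbitrary: d)
    case (Suc n)
    then obtain h t where ht: "num h (Suc n)" "lst t ns" "[d, h, t] \<in> I RCons" using lst_Cons by blast
    then obtain p where p: "num p n" "[p, h] \<in> I RS" using num_pred by blast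
    have "\<exists>e z z'. e \<in> A \<and> z \<in> A \<and> z' \<in> A \<and> [t, p, e, z, z'] \<in> I (RGMA f)"
      using c(7)[of "[d, h, t, p]"] Suc.prems ht p lst_in num_in
      by (auto simp: length_Suc_conv numeral_eq_Suc) blast
    then obtain e z z' where w: "e \<in> A" "z \<in> A" "z' \<in> A" "[t, p, e, z, z'] \<in> I (RGMA f)" by blast
    have in_A: "t \<in> A" "p \<in> A" using ht p lst_in num_in by auto
    have *: "[e, p, t] \<in> I RCons" "[e, z] \<in> I (RG f)" "[z', z] \<in> I RS" "[e] \<in> I (RGM f)"
      using c(8-11)[of "[t, p, e, z, z']"] w in_A by auto
    have e: "lst e (n # ns)" by (rule lst.intros(2)[OF w(1) p(1) ht(2) *(1)])
    with * w assms(2) obtain m where m: "num z m" "rec_eval f (n # ns) m"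
      unfolding computes_def by blast
    \<comment> \<open>\<open>z\<close> has the predecessor \<open>z'\<close>, so every number that
      it represents is positive.\<close>
    have "[z] \<notin> I RZ" using ax(1) w * by blast
    with m obtain k where "m = Suc k" using num_zero_iff by (cases m) auto
    with m Suc.IH[OF e *(4)] show ?case by (auto simp: less_Suc_eq)
  qed simp
  show ?thesis unfolding computes_def
  proof (intro allI impI)
    fix d ns y assume d: "lst d ns" "y \<in> A" "[d, y] \<in> I (RG (Mu f))"
    then have "\<exists>e z. e \<in> A \<and> z \<in> A \<and> [d, y, e, z] \<in> I (RMuA f)"
      using c(1)[of "[d, y]"] lst_in by (auto simp: length_Suc_conv numeral_eq_Suc) blast
    then obtain e z where w: "e \<in> A" "z \<in> A" "[d, y, e, z] \<in> I (RMuA f)" by blast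
    have *: "[y] \<in> I RW" "[e, y, d] \<in> I RCons" "[e, z] \<in> I (RG f)" "[z] \<in> I RZ" "[e] \<in> I (RGM f)"
      using c(2-6)[of "[d, y, e, z]"] w d lst_in by auto
    \<comment> \<open>The chain of predecessors below the guessed \<open>y\<close> supplies a
      number; the remaining clauses verify the search for this number.\<close>
    then obtain n where n: "num y n" using guess_num d by blast
    have e: "lst e (n # ns)" by (rule lst.intros(2)[OF w(1) n d(1) *(2)])
    with * w assms(2) obtain m where m: "num z m" "rec_eval f (n # ns) m"
      unfolding computes_def by blast
    then have "rec_eval f (n # ns) 0" using num_zero_iff * by auto
    with below[OF e *(5)] n show "\<exists>m. num y m \<and> rec_eval (Mu f) ns m" using rec_eval.Mu by blast
  qed
qed

lemma computes_recf:
  assumes "\<forall>c\<in>set (recf_clauses f). holds A I c"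
  shows "computes f"
  using assms
proof (induction f rule: recf_clauses.induct)
  case 1
  then show ?case by (rule computes_zero)
next
  case 2
  then show ?case by (rule computes_succ)
next
  case (3 i)
  then show ?case by (simp add: computes_proj)
next
  case (4 f gs)
  have "computes f" "\<forall>g\<in>set gs. computes g"
    using 4 by (auto simp del: holds.simps)
  with 4(3) show ?case by (rule computes_comp)
next
  case (5 f g)
  have "computes f" "computes g" using 5 by (auto simp del: holds.simps)
  with 5(3) show ?case by (rule computes_prim_rec)
next
  case (6 f)
  have "computes f" using 6 by (auto simp del: holds.simps)
  with 6(2) show ?case by (rule computes_mu)
qed

lemma start_sound:
  assumes f: "\<forall>c\<in>set (recf_clauses f). holds A I c" "\<forall>c\<in>set (start_clauses f). holds A I c"
    and n: "num a n" "[a] \<in> I RInp"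
  shows "\<exists>m. rec_eval f [n] m"
proof -
  have "holds A I (1, 4, [(RInp, [0])], [(RSt, [0, 1, 2, 3])])"
     "holds A I (4, 4, [(RSt, [0, 1, 2, 3])], [(RCons, [1, 0, 2])])"
     "holds A I (4, 4, [(RSt, [0, 1, 2, 3])], [(RNil, [2])])"
     "holds A I (4, 4, [(RSt, [0, 1, 2, 3])], [(RG f, [1, 3])])"
    using f(2) by (simp_all add: start_clauses_def)
  note c = this[THEN holdsD]
  have "\<exists>d t y. d \<in> A \<and> t \<in> A \<and> y \<in> A \<and> [a, d, t, y] \<in> I RSt"
    using c(1)[of "[a]"] n num_in by (auto simp: length_Suc_conv numeral_eq_Suc) blast
  then obtain d t y where w: "d \<in> A" "t \<in> A" "y \<in> A" "[a, d, t, y] \<in> I RSt" by blast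
  have "[d, a, t] \<in> I RCons" "[t] \<in> I RNil" "[d, y] \<in> I (RG f)"
    using c(2-4)[of "[a, d, t, y]"] w n num_in by auto
  then have "lst d [n]" "[d, y] \<in> I (RG f)"
    using lst.intros(2)[OF w(1) n(1) lst.intros(1)[OF w(2)]] by auto
  with w computes_recf[OF f(1)] show ?thesis unfolding computes_def by blast
qed

end

section \<open>Bounded evaluation\<close>

text \<open>Lengths are bounded as well, so that only finitely many lists remain.\<close>

definition bounded :: "nat \<Rightarrow> nat list \<Rightarrow> bool" where
  "bounded N xs \<longleftrightarrow> length xs \<le> N \<and> set xs \<subseteq> {..N}"

text \<open>Evaluation in which all occurring lists and numbers respect the bound \<open>N\<close>,
  so that a derivation lives on the finite set \<open>elems N\<close>. \<open>bevs\<close> and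
  \<open>bmu\<close> will interpret \<open>RGL\<close> and \<open>RGM\<close>; \<open>bmu\<close>
  replaces the universal premise of \<open>Mu\<close> by a recursion, which matches the descent in
  the clauses for \<open>RGM\<close>.\<close>

inductive bev :: "nat \<Rightarrow> recf \<Rightarrow> nat list \<Rightarrow> nat \<Rightarrow> bool"
  and bevs :: "nat \<Rightarrow> nat list \<Rightarrow> recf list \<Rightarrow> nat list \<Rightarrow> bool"
  and bmu :: "nat \<Rightarrow> recf \<Rightarrow> nat list \<Rightarrow> nat \<Rightarrow> bool" for N
where
  "bounded N xs \<Longrightarrow> bev N Zero xs 0"
| "bounded N [x] \<Longrightarrow> Suc x \<le> N \<Longrightarrow> bev N Succ [x] (Suc x)"
| "bounded N xs \<Longrightarrow> i < length xs \<Longrightarrow> bev N (Proj i) xs (xs ! i)"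
| "bevs N xs gs ys \<Longrightarrow> bev N f ys z \<Longrightarrow> bev N (Comp f gs) xs z"
| "bev N f xs y \<Longrightarrow> bounded N (0 # xs) \<Longrightarrow> bev N (PrimRec f g) (0 # xs) y"
| "bev N (PrimRec f g) (n # xs) r \<Longrightarrow> bev N g (n # r # xs) y \<Longrightarrow> bounded N (Suc n # xs)
    \<Longrightarrow> bev N (PrimRec f g) (Suc n # xs) y"
| "bev N f (n # xs) 0 \<Longrightarrow> bmu N f xs n \<Longrightarrow> bev N (Mu f) xs n"
| "bounded N xs \<Longrightarrow> bevs N xs [] []"
| "bev N g xs y \<Longrightarrow> bevs N xs gs ys \<Longrightarrow> bounded N (y # ys) \<Longrightarrow> bevs N xs (g # gs) (y # ys)"
| "bounded N (0 # xs) \<Longrightarrow> bmu N f xs 0"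
| "bmu N f xs n \<Longrightarrow> bev N f (n # xs) (Suc k) \<Longrightarrow> bounded N (Suc n # xs) \<Longrightarrow> bmu N f xs (Suc n)"

inductive_cases bev_Zero: "bev N Zero xs y"
inductive_cases bev_Succ: "bev N Succ xs y"
inductive_cases bev_Proj: "bev N (Proj i) xs y"
inductive_cases bev_Comp: "bev N (Comp f gs) xs y"
inductive_cases bev_PrimRec_Nil: "bev N (PrimRec f g) [] y"
inductive_cases bev_PrimRec_0: "bev N (PrimRec f g) (0 # xs) y"
inductive_cases bev_PrimRec_Suc: "bev N (PrimRec f g) (Suc n # xs) y"
inductive_cases bev_Mu: "bev N (Mu f) xs y"
inductive_cases bevs_Nil: "bevs N xs [] ys"
inductive_cases bevs_Cons: "bevs N xs (g # gs) ys"
inductive_cases bmu_Suc: "bmu N f xs (Suc n)"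

lemma bounded_Cons: "bounded N (x # xs) \<longleftrightarrow> x \<le> N \<and> Suc (length xs) \<le> N \<and> bounded N xs"
  by (auto simp: bounded_def)

lemma bev_bounded:
  "bev N f xs y \<Longrightarrow> bounded N xs \<and> y \<le> N"
  "bevs N ys gs zs \<Longrightarrow> bounded N ys \<and> bounded N zs"
  "bmu N f' vs n \<Longrightarrow> bounded N (n # vs)"
proof (induction rule: bev_bevs_bmu.inducts)
  case (3 xs i)
  then show ?case by (metis atMost_iff bounded_def nth_mem subsetD)
next
  case (8 xs)
  then show ?case by (simp add: bounded_def)
qed (auto simp: bounded_Cons)

lemma eventually_bounded: "\<forall>\<^sub>F N in sequentially. bounded N xs"
  using eventually_ge_at_top[of "length xs + sum_list xs"]
  by eventually_elim (auto simp: bounded_def dest: member_le_sum_list)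

text \<open>A derivation mentions finitely many lists, so every large enough \<open>N\<close>
  serves; the filter spares explicit bounds and maxima over premises.\<close>

lemma rec_eval_eventually_bev:
  "rec_eval f xs y \<Longrightarrow> \<forall>\<^sub>F N in sequentially. bev N f xs y"
proof (induction rule: rec_eval.induct)
  case (Zero xs)
  show ?case using eventually_bounded[of xs] by eventually_elim (rule bev_bevs_bmu.intros)
next
  case (Succ x)
  show ?case using eventually_bounded[of "[x]"] eventually_ge_at_top[of "Suc x"]
    by eventually_elim (rule bev_bevs_bmu.intros)
next
  case (Proj i xs)
  show ?case using eventually_bounded[of xs]
    by eventually_elim (rule bev_bevs_bmu.intros(3)[OF _ Proj])
next
  case (Comp xs gs ys f z)
  from Comp(1) have "\<forall>\<^sub>F N in sequentially. bevs N xs gs ys"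
  proof (induction rule: list_all2_induct)
    case Nil
    show ?case using eventually_bounded[of xs] by eventually_elim (rule bev_bevs_bmu.intros)
  next
    case (Cons g gs y ys)
    then have "\<forall>\<^sub>F N in sequentially. bev N g xs y" by simp
    with Cons.IH eventually_bounded[of "y # ys"] show ?case
      by eventually_elim (rule bev_bevs_bmu.intros)
  qed
  moreover have "\<forall>\<^sub>F N in sequentially. bev N f ys z" using Comp by simp
  ultimately show ?case by eventually_elim (rule bev_bevs_bmu.intros)
next
  case (PrimRec_0 f xs y g)
  from PrimRec_0(2) eventually_bounded[of "0 # xs"] show ?case
    by eventually_elim (rule bev_bevs_bmu.intros)
next
  case (PrimRec_Suc f g n xs r y)
  from PrimRec_Suc(3,4) eventually_bounded[of "Suc n # xs"] show ?case
    by eventually_elim (rule bev_bevs_bmu.intros)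
next
  case (Mu f n xs)
  have "\<forall>\<^sub>F N in sequentially. bmu N f xs m" if "m \<le> n" for m
    using that
  proof (induction m)
    case 0
    show ?case using eventually_bounded[of "0 # xs"] by eventually_elim (rule bev_bevs_bmu.intros)
  next
    case (Suc m)
    then have "m < n" by simp
    then obtain k where "\<forall>\<^sub>F N in sequentially. bev N f (m # xs) (Suc k)" using Mu by blast
    moreover have "\<forall>\<^sub>F N in sequentially. bmu N f xs m" using Suc by simp
    ultimately show ?case using eventually_bounded[of "Suc m # xs"]
      by eventually_elim (rule bev_bevs_bmu.intros)
  qed
  from Mu(2) this[OF order_refl] show ?case by eventually_elim (rule bev_bevs_bmu.intros)
qed

section \<open>The finite structure of a terminating computation\<close>

datatype elem = Num nat | Lst "nat list"

instance elem :: countable by countable_datatype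

definition elems :: "nat \<Rightarrow> elem set" where
  "elems N = Num ` {..N} \<union> Lst ` {xs. bounded N xs}"

lemma finite_elems: "finite (elems N)"
proof -
  have "finite {xs. bounded N xs}"
    using finite_lists_length_le[of "{..N}" N] by (simp add: bounded_def conj_commute)
  then show ?thesis by (simp add: elems_def)
qed

lemma elems_iff [simp]: "Num n \<in> elems N \<longleftrightarrow> n \<le> N" "Lst xs \<in> elems N \<longleftrightarrow> bounded N xs"
  by (auto simp: elems_def)

text \<open>The auxiliary relations consist of the intended witness tuples, so the unfolding clauses
  become inversions of the rules of \<open>bev\<close>, \<open>bevs\<close> and \<open>bmu\<close>.
  \<open>RName\<close> is restricted explicitly because it must be the identity on the
  domain.\<close>

fun trace :: "nat \<Rightarrow> recf \<Rightarrow> nat \<Rightarrow> rel_sym \<Rightarrow> elem list set" where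
  "trace N h x RName = {[a, a] |a. a \<in> elems N}"
| "trace N h x RZ = {[Num 0]}"
| "trace N h x RS = {[Num n, Num (Suc n)] |n. True}"
| "trace N h x RLt = {[Num m, Num n] |m n. m < n}"
| "trace N h x RNil = {[Lst []]}"
| "trace N h x RCons = {[Lst (n # ns), Num n, Lst ns] |n ns. True}"
| "trace N h x RSame = {[a, a] |a. True}"
| "trace N h x RW = {[Num n] |n. True}"
| "trace N h x RWS = {[Num n, Num (Suc n)] |n. True}"
| "trace N h x RInp = {[Num x]}"
| "trace N h x RSt = {[Num x, Lst [x], Lst [], Num y] |y. bev N h [x] y}"
| "trace N h x (RG f) = {[Lst d, Num y] |d y. bev N f d y}"
| "trace N h x (RGL gs) = {[Lst d, Lst e] |d e. bevs N d gs e}"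
| "trace N h x (RGM f) = {[Lst (n # t)] |n t. bmu N f t n}"
| "trace N h x (RCm f gs) = {[Lst d, Num y, Lst e] |d y e. bevs N d gs e \<and> bev N f e y}"
| "trace N h x (RGC g gs) = {[Lst d, Lst (y # t), Num y, Lst t] |d y t. bev N g d y \<and> bevs N d gs t}"
| "trace N h x (RPR f g) =
     {[Num y, Lst t, Num p, Num r, Lst (p # t), Lst (r # t), Lst (p # r # t)] |y t p r.
       bev N (PrimRec f g) (p # t) r \<and> bev N g (p # r # t) y}"
| "trace N h x (RMuA f) = {[Lst d, Num y, Lst (y # d), Num 0] |d y. bev N f (y # d) 0 \<and> bmu N f d y}"
| "trace N h x (RGMA f) =
     {[Lst t, Num n, Lst (n # t), Num (Suc k), Num k] |t n k. bev N f (n # t) (Suc k) \<and> bmu N f t n}"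

lemma holds_iff:
  "holds A I (k, l, as, cs) \<longleftrightarrow> (\<forall>xs. length xs = k \<longrightarrow> set xs \<subseteq> A \<longrightarrow>
     (\<forall>x\<in>set as. map ((!) xs) (snd x) \<in> I (fst x)) \<longrightarrow>
      (\<exists>ys. length ys = l - k \<and> set ys \<subseteq> A \<and> (\<exists>x\<in>set cs. map ((!) (xs @ ys)) (snd x) \<in> I (fst x))))"
  by (simp add: case_prod_unfold)

text \<open>Clauses have a numeral number of variables; such rules turn their list quantifiers into
  quantifiers over single elements.\<close>

lemma all_lists_Suc: "(\<forall>xs. length xs = Suc n \<longrightarrow> P xs) \<longleftrightarrow> (\<forall>x xs. length xs = n \<longrightarrow> P (x # xs))"
  by (auto simp: length_Suc_conv)

lemma ex_lists_Suc: "(\<exists>xs. length xs = Suc n \<and> P xs) \<longleftrightarrow> (\<exists>x xs. length xs = n \<and> P (x # xs))"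
  by (auto simp: length_Suc_conv)

lemmas holds_unfold = holds_iff all_lists_Suc ex_lists_Suc numeral_eq_Suc

lemma guess_trace: "holds (elems N) (trace N h x) (1, 2, [(RW, [0])], [(RZ, [0]), (RWS, [1, 0])])"
proof -
  \<comment> \<open>For zero the disjunct \<open>RZ\<close> does not mention the existential
    variable, which gets the dummy value \<open>Num 0\<close>.\<close>
  have "\<exists>a. a \<in> elems N \<and> (n = 0 \<or> (\<exists>m. a = Num m \<and> n = Suc m))" if "n \<le> N" for n
    using that by (cases n) (auto intro: exI[of _ "Num 0"])
  then show ?thesis by (auto simp: holds_unfold simp del: holds.simps)
qed

lemma base_trace: "\<forall>c\<in>set base_clauses. holds (elems N) (trace N h x) c"
  unfolding base_clauses_def list.set ball_simps
  by (intro conjI guess_trace; auto simp: holds_unfold simp del: holds.simps)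

lemma proj_trace: "\<forall>c\<in>set (proj_clauses i). holds (elems N) (trace N h x) c"
proof (induction i)
  case 0
  show ?case unfolding proj_clauses.simps list.set ball_simps
    by (intro conjI; auto simp: holds_unfold elim!: bev_Proj simp del: holds.simps)
next
  case (Suc i)
  have "bev N (Proj i) ns ((n # ns) ! Suc i)" if "i < length ns" "bounded N (n # ns)" for n ns
    using that bev_bevs_bmu.intros(3)[of N ns i] by (simp add: bounded_Cons)
  then show ?case using Suc unfolding proj_clauses.simps set_append ball_Un list.set ball_simps
    by (intro conjI; auto simp: holds_unfold elim!: bev_Proj simp del: holds.simps)
qed

lemma list_trace: "\<forall>c\<in>set (list_clauses gs). holds (elems N) (trace N h x) c"
proof (induction gs)
  case Nil
  show ?case by (auto simp: holds_unfold elim!: bevs_Nil simp del: holds.simps)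
next
  case (Cons g gs)
  have "holds (elems N) (trace N h x) (2, 4, [(RGL (g # gs), [0, 1])], [(RGC g gs, [0, 1, 2, 3])])"
    by (auto simp: holds_unfold elim!: bevs_Cons simp del: holds.simps)
      (metis bev_bounded(1,2) bounded_Cons elems_iff)+
  with Cons show ?case unfolding list_clauses.simps set_append ball_Un list.set ball_simps
    by (intro conjI; auto simp: holds_unfold simp del: holds.simps)
qed

lemma prim_rec_trace:
  "holds (elems N) (trace N h x) (5, 9, [(RG (PrimRec f g), [0, 1]), (RCons, [0, 2, 3]), (RS, [4, 2])],
        [(RPR f g, [1, 3, 4, 5, 6, 7, 8])])"
proof -
  have "\<exists>r e1 u e2. r \<in> elems N \<and> e1 \<in> elems N \<and> u \<in> elems N \<and> e2 \<in> elems N \<and>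
     (\<exists>r'. r = Num r' \<and> e1 = Lst (n # t) \<and> u = Lst (r' # t) \<and> e2 = Lst (n # r' # t)
        \<and> bev N (PrimRec f g) (n # t) r' \<and> bev N g (n # r' # t) y)"
    if bev: "bev N (PrimRec f g) (Suc n # t) y" for n t y
  proof -
    from bev obtain r where r: "bev N (PrimRec f g) (n # t) r" "bev N g (n # r # t) y"
      by (auto elim!: bev_PrimRec_Suc)
    then have "bounded N (n # t)" "bounded N (n # r # t)" "bounded N (r # t)" "r \<le> N"
      using bev_bounded(1)[OF r(1)] bev_bounded(1)[OF r(2)] by (auto simp: bounded_Cons)
    with r show ?thesis
      by (intro exI[of _ "Num r"] exI[of _ "Lst (n # t)"] exI[of _ "Lst (r # t)"] exI[of _ "Lst (n # r # t)"]) auto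
  qed
  then show ?thesis by (auto simp: holds_unfold simp del: holds.simps)
qed

lemma mu_trace:
  "holds (elems N) (trace N h x) (2, 4, [(RG (Mu f), [0, 1])], [(RMuA f, [0, 1, 2, 3])])"
  "holds (elems N) (trace N h x)
     (4, 7, [(RGM f, [0]), (RCons, [0, 1, 2]), (RS, [3, 1])], [(RGMA f, [2, 3, 4, 5, 6])])"
proof -
  have "\<exists>e z. e \<in> elems N \<and> z \<in> elems N \<and> e = Lst (y # d) \<and> z = Num 0 \<and> bev N f (y # d) 0 \<and> bmu N f d y"
    if bev: "bev N (Mu f) d y" for d y
    using bev by (auto elim!: bev_Mu dest: bev_bounded)
  then show "holds (elems N) (trace N h x) (2, 4, [(RG (Mu f), [0, 1])], [(RMuA f, [0, 1, 2, 3])])"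
    by (auto simp: holds_unfold simp del: holds.simps)
  have "\<exists>e z z'. e \<in> elems N \<and> z \<in> elems N \<and> z' \<in> elems N \<and>
     (\<exists>k. e = Lst (n # t) \<and> z = Num (Suc k) \<and> z' = Num k \<and> bev N f (n # t) (Suc k) \<and> bmu N f t n)"
    if bmu: "bmu N f t (Suc n)" for t n
  proof -
    from bmu obtain k where "bev N f (n # t) (Suc k)" "bmu N f t n" by (auto elim!: bmu_Suc)
    moreover then have "bounded N (n # t)" "Suc k \<le> N" by (auto dest: bev_bounded)
    ultimately show ?thesis
      by (intro exI[of _ "Lst (n # t)"] exI[of _ "Num (Suc k)"] exI[of _ "Num k"]) auto
  qed
  then show "holds (elems N) (trace N h x)
     (4, 7, [(RGM f, [0]), (RCons, [0, 1, 2]), (RS, [3, 1])], [(RGMA f, [2, 3, 4, 5, 6])])"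
    by (auto simp: holds_unfold simp del: holds.simps)
qed

text \<open>Inverting the evaluation rules yields the witnesses, and \<open>bev_bounded\<close>
  places them in \<open>elems N\<close>.\<close>

lemma recf_trace: "\<forall>c\<in>set (recf_clauses f). holds (elems N) (trace N h x) c"
proof (induction f rule: recf_clauses.induct)
  case 1
  show ?case by (auto simp: holds_unfold elim!: bev_Zero simp del: holds.simps)
next
  case 2
  show ?case unfolding recf_clauses.simps list.set ball_simps
    by (intro conjI; auto simp: holds_unfold elim!: bev_Succ simp del: holds.simps)
next
  case (3 i)
  show ?case by (simp add: proj_trace del: holds.simps)
next
  case (4 f gs)
  have "holds (elems N) (trace N h x) (2, 3, [(RG (Comp f gs), [0, 1])], [(RCm f gs, [0, 1, 2])])"
    by (auto simp: holds_unfold elim!: bev_Comp simp del: holds.simps) (metis bev_bounded(1) elems_iff(2))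
  moreover have "\<forall>c\<in>set (concat (map recf_clauses gs)). holds (elems N) (trace N h x) c"
    using 4 by auto
  ultimately show ?case using 4 list_trace[of gs]
    unfolding recf_clauses.simps set_append ball_Un list.set ball_simps
    by (intro conjI; (assumption | blast)?; auto simp: holds_unfold simp del: holds.simps)
next
  case (5 f g)
  then show ?case using prim_rec_trace[of N h x f g]
    unfolding recf_clauses.simps set_append ball_Un list.set ball_simps
    by (intro conjI; assumption?;
        auto simp: holds_unfold elim!: bev_PrimRec_Nil bev_PrimRec_0 simp del: holds.simps)
next
  case (6 f)
  then show ?case using mu_trace[of N h x f]
    unfolding recf_clauses.simps set_append ball_Un list.set ball_simps
    by (intro conjI; assumption?; auto simp: holds_unfold simp del: holds.simps)
qed

lemma start_trace:
  assumes "bev N h [x] y"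
  shows "\<forall>c\<in>set (start_clauses h). holds (elems N) (trace N h x) c"
proof -
  have "bounded N [x]" "bounded N []" "y \<le> N" using bev_bounded(1)[OF assms] by (auto simp: bounded_Cons)
  then have "\<exists>d t z. d \<in> elems N \<and> t \<in> elems N \<and> z \<in> elems N \<and>
      (d = Lst [x] \<and> t = Lst [] \<and> (\<exists>y. z = Num y \<and> bev N h [x] y))"
    using assms by (intro exI[of _ "Lst [x]"] exI[of _ "Lst []"] exI[of _ "Num y"]) auto
  then have "holds (elems N) (trace N h x) (1, 4, [(RInp, [0])], [(RSt, [0, 1, 2, 3])])"
    by (auto simp: holds_unfold simp del: holds.simps)
  then show ?thesis unfolding start_clauses_def list.set ball_simps
    by (intro conjI; assumption?; auto simp: holds_unfold simp del: holds.simps)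
qed

section \<open>Undecidability\<close>

definition halting_clauses :: "recf \<Rightarrow> clause list" where
  "halting_clauses f = base_clauses @ recf_clauses f @ start_clauses f"

definition halting_syms :: "recf \<Rightarrow> rel_sym set" where
  "halting_syms f = base_syms \<union> (\<Union>c\<in>set (halting_clauses f). clause_syms c)"

lemma sat_imp_halts:
  assumes w: "finite w" and thy: "\<forall>\<phi>\<in>theory_fms (halting_syms f) (set (halting_clauses f)). msat V w \<phi>"
    and zero: "msat V w zero_fm" and inp: "msat V w (input_fm x)"
  shows "\<exists>y. rec_eval f [x] y"
proof -
  interpret theory_model V w "halting_syms f" "set (halting_clauses f)"
  proof
    show "wf_clause c" if "c \<in> set (halting_clauses f)" for c
      using that wf_recf_clauses by (auto simp: halting_clauses_def)
  qed (use w thy in \<open>auto simp: halting_syms_def\<close>)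
  interpret fo: fo_model names interp
    using finite_names holds_interp by unfold_locales (auto simp: halting_clauses_def)
  obtain c b where c: "[c 0] \<in> interp RZ" "[c x] \<in> interp RInp" "\<forall>k\<le>x. c k \<in> names"
    and b: "\<forall>k<x. b k \<in> names \<and> [c k, b k] \<in> interp RSame \<and> [b k, c (Suc k)] \<in> interp RS"
    using input_interp[OF zero inp] by (auto simp: halting_syms_def)
  \<comment> \<open>\<open>RSame\<close> leads from the copy of \<open>k\<close> in sort 0 to the
    one in sort 1, and \<open>RS\<close> from there to \<open>Suc k\<close> in sort 0.\<close>
  have "fo.num (c k) k" if "k \<le> x" for k
    using that
  proof (induction k)
    case 0
    then show ?case using c by (intro fo.num.intros(1)) auto
  next
    case (Suc k)
    then have "fo.num (c k) k" "b k \<in> names" "[c k, b k] \<in> interp RSame" "[b k, c (Suc k)] \<in> interp RS"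
      using b by simp_all
    then have "fo.num (b k) k" using fo.num_same by blast
    then show ?case
      using Suc.prems c(3) \<open>[b k, c (Suc k)] \<in> interp RS\<close> by (intro fo.num.intros(2)) simp_all
  qed
  then have "fo.num (c x) x" by simp
  moreover have "\<forall>d\<in>set (recf_clauses f). holds names interp d" "\<forall>d\<in>set (start_clauses f). holds names interp d"
    using holds_interp by (simp_all add: halting_clauses_def del: holds.simps)
  ultimately show ?thesis using c(2) by (intro fo.start_sound)
qed

lemma halts_imp_sat:
  assumes "rec_eval f [x] y"
  shows "\<exists>V w. finite w \<and> w \<noteq> {} \<and>
    (\<forall>\<phi>\<in>theory_fms (halting_syms f) (set (halting_clauses f)). msat V w \<phi>)
    \<and> msat V w zero_fm \<and> msat V w (input_fm x)"
proof -
  obtain N where N: "bev N f [x] y"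
    using eventually_happens'[OF _ rec_eval_eventually_bev[OF assms]] by auto
  then have "x \<le> N" using bev_bounded(1)[OF N] by (simp add: bounded_Cons)
  interpret m: intended_model "elems N" "trace N f x" name_sort Num
    by unfold_locales (rule finite_elems, auto simp: name_sort_def elems_def)
  have "\<forall>c\<in>set (halting_clauses f). holds (elems N) (trace N f x) c"
    unfolding halting_clauses_def set_append ball_Un
    by (intro conjI base_trace recf_trace start_trace[OF N])
  moreover have "\<forall>c\<in>set (halting_clauses f). wf_clause c"
    unfolding halting_clauses_def set_append ball_Un by (intro conjI wf_recf_clauses)
  ultimately have "msat m.val m.root \<phi>" if "\<phi> \<in> theory_fms (halting_syms f) (set (halting_clauses f))" for \<phi>
    by (intro m.theory_fms_true[OF refl _ _ _ that]; (blast | simp))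
  moreover have "msat m.val m.root zero_fm" "msat m.val m.root (input_fm x)"
    using \<open>x \<le> N\<close> by (intro m.input_true; simp)+
  ultimately show ?thesis using m.finite_root m.root_nonempty by blast
qed

text \<open>The order of quantifiers matters: \<psi> is chosen before \<open>x\<close>, so
  \<open>x\<close> may later be the code of \<psi>. A single formula exists because the theory of a
  program is finite.\<close>

lemma halting_formula:
  "\<exists>\<psi>. \<forall>x. Imp \<psi> (Neg (input_fm x)) \<notin> MLBox \<longleftrightarrow> (\<exists>y. rec_eval f [x] y)"
proof -
  let ?\<Phi> = "theory_fms (halting_syms f) (set (halting_clauses f))"
  have "finite (halting_syms f)"
    by (auto simp: halting_syms_def base_syms_def clause_syms_def)
  then have "finite ?\<Phi>" by (intro finite_theory_fms) auto
  then obtain \<phi>s where \<phi>s: "set \<phi>s = insert zero_fm ?\<Phi>" using finite_list by (metis finite_insert)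
  have "Imp (conjs \<phi>s) (Neg (input_fm x)) \<notin> MLBox \<longleftrightarrow> (\<exists>y. rec_eval f [x] y)" for x
  proof -
    have "Imp (conjs \<phi>s) (Neg (input_fm x)) \<notin> MLBox \<longleftrightarrow> (\<exists>V w. finite w \<and> w \<noteq> {} \<and>
        (\<forall>\<phi>\<in>?\<Phi>. msat V w \<phi>) \<and> msat V w zero_fm \<and> msat V w (input_fm x))"
      unfolding not_in_MLBox_iff by (simp add: \<phi>s conj_ac)
    also have "\<dots> \<longleftrightarrow> (\<exists>y. rec_eval f [x] y)"
      by (intro iffI; elim exE conjE) (erule (3) sat_imp_halts, erule halts_imp_sat)
    finally show ?thesis .
  qed
  then show ?thesis by blast
qed

section \<open>Computability of the code of the input formula\<close>

definition computable :: "nat \<Rightarrow> (nat list \<Rightarrow> nat) \<Rightarrow> bool" where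
  "computable n h \<longleftrightarrow> (\<exists>r. \<forall>xs. length xs = n \<longrightarrow> rec_eval r xs (h xs))"

lemma computable_proj: "i < n \<Longrightarrow> computable n (\<lambda>xs. xs ! i)"
  unfolding computable_def by (intro exI[of _ "Proj i"]) (auto intro: rec_eval.Proj)

lemma computable_comp1:
  assumes "computable 1 h" "computable n g"
  shows "computable n (\<lambda>xs. h [g xs])"
proof -
  from assms obtain r s where "\<forall>xs. length xs = 1 \<longrightarrow> rec_eval r xs (h xs)"
    "\<forall>xs. length xs = n \<longrightarrow> rec_eval s xs (g xs)" unfolding computable_def by blast
  then have "rec_eval (Comp r [s]) xs (h [g xs])" if "length xs = n" for xs
    using that by (intro rec_eval.Comp[where ys = "[g xs]"]) auto
  then show ?thesis unfolding computable_def by blast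
qed

lemma computable_comp2:
  assumes "computable 2 h" "computable n g" "computable n g'"
  shows "computable n (\<lambda>xs. h [g xs, g' xs])"
proof -
  from assms obtain r s s' where "\<forall>xs. length xs = 2 \<longrightarrow> rec_eval r xs (h xs)"
    "\<forall>xs. length xs = n \<longrightarrow> rec_eval s xs (g xs)" "\<forall>xs. length xs = n \<longrightarrow> rec_eval s' xs (g' xs)"
    unfolding computable_def by blast
  then have "rec_eval (Comp r [s, s']) xs (h [g xs, g' xs])" if "length xs = n" for xs
    using that by (intro rec_eval.Comp[where ys = "[g xs, g' xs]"]) auto
  then show ?thesis unfolding computable_def by blast
qed

lemma computable_Suc:
  assumes "computable n g"
  shows "computable n (\<lambda>xs. Suc (g xs))"
proof -
  have "computable 1 (\<lambda>xs. Suc (xs ! 0))"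
    unfolding computable_def
    by (intro exI[of _ Succ]) (auto simp: length_Suc_conv intro: rec_eval.Succ)
  from computable_comp1[OF this assms] show ?thesis by simp
qed

lemma computable_const: "computable n (\<lambda>_. c)"
proof (induction c)
  case 0
  show ?case unfolding computable_def by (intro exI[of _ Zero]) (auto intro: rec_eval.Zero)
qed (rule computable_Suc)

lemma computable_prim_rec:
  assumes "computable n b" "computable (Suc (Suc n)) s"
  shows "computable (Suc n) (\<lambda>xs. rec_nat (b (tl xs)) (\<lambda>m r. s (m # r # tl xs)) (hd xs))"
proof -
  from assms obtain p q where p: "\<And>xs. length xs = n \<Longrightarrow> rec_eval p xs (b xs)"
    and q: "\<And>xs. length xs = Suc (Suc n) \<Longrightarrow> rec_eval q xs (s xs)" unfolding computable_def by blast
  have "rec_eval (PrimRec p q) (k # xs) (rec_nat (b xs) (\<lambda>m r. s (m # r # xs)) k)"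
    if "length xs = n" for k xs
  proof (induction k)
    case 0
    show ?case using that by (auto intro: rec_eval.PrimRec_0 p)
  next
    case (Suc k)
    then show ?case using that q[of "k # _ # xs"] by (auto intro: rec_eval.PrimRec_Suc)
  qed
  then show ?thesis unfolding computable_def
    by (intro exI[of _ "PrimRec p q"]) (auto simp: length_Suc_conv)
qed

lemma computable_cong:
  "computable n g \<Longrightarrow> (\<And>xs. length xs = n \<Longrightarrow> g xs = h xs) \<Longrightarrow> computable n h"
  unfolding computable_def by metis

lemma computable_add:
  assumes "computable n g" "computable n h"
  shows "computable n (\<lambda>xs. g xs + h xs)"
proof -
  have "computable (Suc 1) (\<lambda>xs. rec_nat (tl xs ! 0) (\<lambda>m r. Suc ((m # r # tl xs) ! 1)) (hd xs))"
    by (intro computable_prim_rec[of 1 "\<lambda>xs. xs ! 0" "\<lambda>xs. Suc (xs ! 1)"] computable_Suc computable_proj) auto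
  then have "computable 2 (\<lambda>xs. xs ! 0 + xs ! 1)"
    unfolding numeral_2_eq_2 One_nat_def
  proof (rule computable_cong)
    fix xs :: "nat list" assume "length xs = Suc (Suc 0)"
    then obtain a b where xs: "xs = [a, b]" by (auto simp: length_Suc_conv)
    have "rec_nat b (\<lambda>m r. Suc r) a = a + b" by (induction a) auto
    then show "rec_nat (tl xs ! 0) (\<lambda>m r. Suc ((m # r # tl xs) ! Suc 0)) (hd xs) = xs ! 0 + xs ! Suc 0"
      by (simp add: xs)
  qed
  from computable_comp2[OF this assms] show ?thesis by simp
qed

lemma computable_triangle:
  assumes "computable n g"
  shows "computable n (\<lambda>xs. triangle (g xs))"
proof -
  have "computable (Suc 0) (\<lambda>xs. rec_nat 0 (\<lambda>m r. (m # r # tl xs) ! 1 + Suc ((m # r # tl xs) ! 0)) (hd xs))"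
    by (intro computable_prim_rec[of 0 "\<lambda>_. 0" "\<lambda>xs. xs ! 1 + Suc (xs ! 0)"]
        computable_add computable_Suc computable_proj computable_const) auto
  then have "computable 1 (\<lambda>xs. triangle (xs ! 0))"
    unfolding One_nat_def
  proof (rule computable_cong)
    fix xs :: "nat list" assume "length xs = Suc 0"
    then obtain a where xs: "xs = [a]" by (auto simp: length_Suc_conv)
    have "rec_nat 0 (\<lambda>m r. r + Suc m) a = triangle a" by (induction a) auto
    then show "rec_nat 0 (\<lambda>m r. (m # r # tl xs) ! Suc 0 + Suc ((m # r # tl xs) ! 0)) (hd xs) = triangle (xs ! 0)"
      by (simp add: xs)
  qed
  from computable_comp1[OF this assms] show ?thesis by simp
qed

lemma computable_prod_encode:
  "computable n g \<Longrightarrow> computable n h \<Longrightarrow> computable n (\<lambda>xs. prod_encode (g xs, h xs))"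
  unfolding prod_encode_def by (simp add: computable_add computable_triangle)

lemma computable_fm_code:
  "computable n g \<Longrightarrow> computable n (\<lambda>xs. fm_code (Atom (g xs)))"
  "computable n (\<lambda>xs. fm_code (F xs)) \<Longrightarrow> computable n (\<lambda>xs. fm_code (G xs)) \<Longrightarrow>
    computable n (\<lambda>xs. fm_code (Imp (F xs) (G xs)))"
  "computable n (\<lambda>xs. fm_code (F xs)) \<Longrightarrow> computable n (\<lambda>xs. fm_code (Box (F xs)))"
  by (auto intro!: computable_prod_encode computable_const)

lemma computable_steps_fm: "computable 1 (\<lambda>xs. fm_code (steps_fm (xs ! 0)))"
proof -
  \<comment> \<open>The second argument is a code, not a formula: \<open>s\<close> builds the code
    of a conjunction around it, with \<open>Conj\<close> expanded into implications and
    \<open>Bot\<close>.\<close>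
  define s where "s xs = prod_encode (2, prod_encode (prod_encode (2, prod_encode (fm_code (step_fm (xs ! 0)),
    prod_encode (2, prod_encode (xs ! 1, fm_code Bot)))), fm_code Bot))" for xs :: "nat list"
  have s: "s [k, fm_code \<phi>] = fm_code (Conj (step_fm k) \<phi>)" for k \<phi>
    by (simp add: s_def Conj_def Neg_def)
  have "computable (Suc (Suc 0)) s"
    unfolding s_def step_fm_def nominal_def linked_def chA_def chB_def Conj_def Dia_def Neg_def
    by (intro computable_prod_encode computable_fm_code computable_const computable_Suc computable_proj) auto
  then have "computable (Suc 0) (\<lambda>xs. rec_nat (fm_code (Neg Bot)) (\<lambda>m r. s (m # r # tl xs)) (hd xs))"
    by (intro computable_prim_rec[of 0 "\<lambda>_. fm_code (Neg Bot)" s] computable_const)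
  then show ?thesis
    unfolding One_nat_def
  proof (rule computable_cong)
    fix xs :: "nat list" assume "length xs = Suc 0"
    then obtain a where xs: "xs = [a]" by (auto simp: length_Suc_conv)
    have "rec_nat (fm_code (Neg Bot)) (\<lambda>m r. s [m, r]) a = fm_code (steps_fm a)"
      by (induction a) (simp_all only: old.nat.simps steps_fm.simps s)
    then show "rec_nat (fm_code (Neg Bot)) (\<lambda>m r. s (m # r # tl xs)) (hd xs) = fm_code (steps_fm (xs ! 0))"
      by (simp add: xs)
  qed
qed

lemma computable_neg_input_fm: "computable 1 (\<lambda>xs. fm_code (Neg (input_fm (xs ! 0))))"
  unfolding input_fm_def chA_def Conj_def Dia_def Neg_def
  by (intro computable_steps_fm computable_prod_encode computable_fm_code computable_const computable_proj) auto

text \<open>The program \<open>Mu h\<close> is built from the decider before any formula is known.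
  Its formula \<psi> then comes from \<open>halting_formula\<close>, and the code of \<psi> is a
  legitimate input for it.\<close>

theorem corollary1p8: "\<not> decidable fm_code MLBox"
proof
  assume "decidable fm_code MLBox"
  then obtain D where D: "\<And>\<phi>. rec_eval D [fm_code \<phi>] (if \<phi> \<in> MLBox then 1 else 0)"
    unfolding decidable_def by blast
  \<comment> \<open>The tag 2 is that of implications. The number \<open>xs ! 0\<close> plays the
    code of the antecedent and is inserted without being decoded.\<close>
  have "computable 1 (\<lambda>xs. prod_encode (2, prod_encode (xs ! 0, fm_code (Neg (input_fm (xs ! 0))))))"
    by (intro computable_prod_encode computable_const computable_proj computable_neg_input_fm) auto
  then obtain q where "\<forall>xs. length xs = 1 \<longrightarrow>
      rec_eval q xs (prod_encode (2, prod_encode (xs ! 0, fm_code (Neg (input_fm (xs ! 0))))))"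
    unfolding computable_def by blast
  then have q: "rec_eval q [x] (prod_encode (2, prod_encode (x, fm_code (Neg (input_fm x)))))" for x
    by (auto dest: spec[of _ "[x]"])
  \<comment> \<open>Exchanges 0 and 1, since \<open>Mu\<close> looks for a zero and should find one
    when the decider answers 1.\<close>
  define flip where "flip = PrimRec (Comp Succ [Zero]) Zero"
  have flip: "rec_eval flip [0] 1" "rec_eval flip [Suc 0] 0"
  proof -
    have "rec_eval (Comp Succ [Zero]) [] (Suc 0)"
      by (rule rec_eval.Comp[where ys = "[0]"]) (auto intro: rec_eval.intros)
    then show "rec_eval flip [0] 1" unfolding flip_def by (auto intro: rec_eval.PrimRec_0)
    then show "rec_eval flip [Suc 0] 0" unfolding flip_def
      by (auto intro: rec_eval.PrimRec_Suc rec_eval.Zero)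
  qed
  \<comment> \<open>\<open>Proj 1\<close> skips the search variable, so \<open>Mu h\<close> stops at
    0 or never.\<close>
  define h where "h = Comp flip [Comp D [Comp q [Proj 1]]]"
  obtain \<psi> where \<psi>: "\<And>x. Imp \<psi> (Neg (input_fm x)) \<notin> MLBox \<longleftrightarrow> (\<exists>y. rec_eval (Mu h) [x] y)"
    using halting_formula by blast
  define x where "x = fm_code \<psi>"
  define \<phi> where "\<phi> = Imp \<psi> (Neg (input_fm x))"
  have h: "rec_eval h [n, x] (if \<phi> \<in> MLBox then 0 else 1)" for n
  proof -
    have "rec_eval (Proj 1) [n, x] ([n, x] ! 1)" by (rule rec_eval.Proj) simp
    then have "rec_eval (Comp q [Proj 1]) [n, x] (fm_code \<phi>)"
      using q[of x] by (intro rec_eval.Comp[where ys = "[x]"]) (auto simp: \<phi>_def x_def)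
    then have "rec_eval (Comp D [Comp q [Proj 1]]) [n, x] (if \<phi> \<in> MLBox then 1 else 0)"
      using D[of \<phi>] by (intro rec_eval.Comp[where ys = "[fm_code \<phi>]"]) auto
    then show ?thesis unfolding h_def using flip
      by (intro rec_eval.Comp[where ys = "[if \<phi> \<in> MLBox then 1 else 0]"]) auto
  qed
  show False
  proof (cases "\<phi> \<in> MLBox")
    case True
    then have "rec_eval (Mu h) [x] 0" using h[of 0] by (intro rec_eval.Mu) auto
    with \<psi>[of x] True show False by (auto simp: \<phi>_def)
  next
    case False
    then obtain y where "rec_eval (Mu h) [x] y" using \<psi>[of x] by (auto simp: \<phi>_def)
    then have "rec_eval h [y, x] 0" by (cases rule: rec_eval.cases) auto
    with h[of y] False show False using rec_eval_deterministic by fastforce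
  qed
qed

end
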